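(* Let $K$ be an algebraically closed field of arbitrary characteristic, $V=K^n$, and $X=V^{\oplus m}\oplus(V^* )^{\oplus q}$ with $m,q>n$ and the diagonal action of $GL(V)$. For $1\le i\le m$, $1\le j\le q$ let $\varphi_{ij}\in K[X]$ be the function $\varphi_{ij}(u_1,\dots,u_m,\xi_1,\dots,\xi_q)=\xi_j(u_i)$. (1) (First fundamental theorem) The ring of invariants $K[X]^{GL(V)}$ is generated as a $K$-algebra by $\varphi_{ij}$, $1\le i\le m$, $1\le j\le q$. (2) (Second fundamental theorem) The ideal of relations among the generators in (1) is generated by the $(n+1)$-minors of the $m\times q$ matrix $(\varphi_{ij})$; that is, the kernel of the $K$-algebra map $K[x_{ij},1\le i\le m,1\le j\le q]\to K[X]^{GL(V)}$, $x_{ij}\mapsto\varphi_{ij}$, is generated by the $(n+1)$-minors of $(x_{ij})$.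
   Context: $GL(V)$ acts on $X$ by $g\cdot(u_1,\dots,u_m,\xi_1,\dots,\xi_q)=(gu_1,\dots,gu_m,\xi_1^g,\dots,\xi_q^g)$, $u_i\in V$, $\xi_j\in V^*$, where $\xi^g(v)=\xi(g^{-1}v)$. *)

theory Defs
  imports "HOL-Analysis.Analysis" "HOL-Library.Poly_Mapping"
    "HOL-Computational_Algebra.Polynomial"
begin

text \<open>
  \<open>V = K\<^sup>n\<close> is \<open>'k ^ 'n\<close> with \<open>n = CARD('n)\<close>; the \<open>m\<close> vectors are indexed by \<open>'m\<close> and the
  \<open>q\<close> functionals by \<open>'q\<close>.
\<close>

typedef (overloaded) ('k, 'n) dual =
  "{\<xi> :: 'k::field ^ 'n::finite \<Rightarrow> 'k. Vector_Spaces.linear (*s) (*) \<xi>}"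
  morphisms dual_apply Dual
proof
  show "(\<lambda>_. 0) \<in> {\<xi> :: 'k ^ 'n \<Rightarrow> 'k. Vector_Spaces.linear (*s) (*) \<xi>}"
    by (auto simp: Vector_Spaces.linear_iff vector_space_def algebra_simps)
qed

type_synonym ('k, 'n, 'm, 'q) space = "('m \<Rightarrow> 'k ^ 'n) \<times> ('q \<Rightarrow> ('k, 'n) dual)"

definition GL :: "('k::field ^ 'n::finite \<Rightarrow> 'k ^ 'n) set" where
  "GL = {g. Vector_Spaces.linear (*s) (*s) g \<and> bij g}"

definition dual_act ::
  "('k::field ^ 'n::finite \<Rightarrow> 'k ^ 'n) \<Rightarrow> ('k, 'n) dual \<Rightarrow> ('k, 'n) dual" where
  "dual_act g \<xi> = Dual (\<lambda>v. dual_apply \<xi> (inv g v))"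

definition act ::
  "('k::field ^ 'n::finite \<Rightarrow> 'k ^ 'n) \<Rightarrow> ('k, 'n, 'm, 'q) space \<Rightarrow> ('k, 'n, 'm, 'q) space" where
  "act g x = (\<lambda>i. g (fst x i), \<lambda>j. dual_act g (snd x j))"

lemma dual_apply_dual_act:
  assumes "g \<in> GL"
  shows "dual_apply (dual_act g \<xi>) v = dual_apply \<xi> (inv g v)"
proof -
  have g: "Vector_Spaces.linear (*s) (*s) g" "bij g"
    using assms by (auto simp: GL_def)
  have "Vector_Spaces.linear (*s) (*s) (inv g)"
    using g vec.linear_injective_left_inverse[OF g(1)]
    by (metis bij_def inv_unique_comp vec.linear_injective_imp_surjective vec.linear_inverse_left)
  then have "Vector_Spaces.linear (*s) (*) (dual_apply \<xi> \<circ> inv g)"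
    using dual_apply[of \<xi>] by (auto intro: Vector_Spaces.linear_compose)
  then show ?thesis
    by (simp add: dual_act_def Dual_inverse comp_def)
qed

inductive_set generated_algebra :: "('x \<Rightarrow> 'k::comm_ring_1) set \<Rightarrow> ('x \<Rightarrow> 'k) set"
  for S :: "('x \<Rightarrow> 'k) set" where
  gen: "f \<in> S \<Longrightarrow> f \<in> generated_algebra S"
| const: "(\<lambda>_. c) \<in> generated_algebra S"
| add: "f \<in> generated_algebra S \<Longrightarrow> h \<in> generated_algebra S \<Longrightarrow>
    (\<lambda>x. f x + h x) \<in> generated_algebra S"
| mult: "f \<in> generated_algebra S \<Longrightarrow> h \<in> generated_algebra S \<Longrightarrow>
    (\<lambda>x. f x * h x) \<in> generated_algebra S"

text \<open>
  \<open>K[X]\<close> is the algebra of polynomial functions on \<open>X\<close>, generated by the coordinates with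
  respect to the standard basis \<open>axis a 1\<close> of \<open>V\<close> and its dual basis. Over an infinite field, in
  particular an algebraically closed one, it is the polynomial ring in these coordinates.
\<close>

definition coordinate_functions :: "(('k::field, 'n::finite, 'm, 'q) space \<Rightarrow> 'k) set" where
  "coordinate_functions =
     {f. \<exists>i a. f = (\<lambda>x. fst x i $ a)} \<union> {f. \<exists>j a. f = (\<lambda>x. dual_apply (snd x j) (axis a 1))}"

definition coordinate_ring :: "(('k::field, 'n::finite, 'm, 'q) space \<Rightarrow> 'k) set" where
  "coordinate_ring = generated_algebra coordinate_functions"

definition invariants :: "(('k::field, 'n::finite, 'm, 'q) space \<Rightarrow> 'k) set" where
  "invariants = {f \<in> coordinate_ring. \<forall>g\<in>GL. \<forall>x. f (act g x) = f x}"

definition \<phi> :: "'m \<Rightarrow> 'q \<Rightarrow> ('k::field, 'n::finite, 'm, 'q) space \<Rightarrow> 'k" where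
  "\<phi> i j x = dual_apply (snd x j) (fst x i)"

text \<open>Polynomials over \<open>'k\<close> in the indeterminates \<open>'v\<close>, as finitely supported families of
  coefficients indexed by exponent vectors.\<close>

type_synonym ('v, 'k) mpoly = "('v \<Rightarrow>\<^sub>0 nat) \<Rightarrow>\<^sub>0 'k"

definition indet :: "'v \<Rightarrow> ('v, 'k::comm_ring_1) mpoly" where
  "indet v = Poly_Mapping.single (Poly_Mapping.single v 1) 1"

text \<open>The \<open>'k\<close>-algebra homomorphism to the algebra of functions with \<open>indet v \<mapsto> F v\<close>;
  see \<open>substitute_const\<close> to \<open>substitute_mult\<close> below.\<close>

definition substitute ::
  "('v \<Rightarrow> 'x \<Rightarrow> 'k) \<Rightarrow> ('v, 'k::comm_ring_1) mpoly \<Rightarrow> 'x \<Rightarrow> 'k" where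
  "substitute F p = (\<lambda>x. \<Sum>t\<in>Poly_Mapping.keys p.
     Poly_Mapping.lookup p t *
       (\<Prod>v\<in>Poly_Mapping.keys t. F v x ^ Poly_Mapping.lookup t v))"

definition ideal_generated :: "'a::comm_ring_1 set \<Rightarrow> 'a set" where
  "ideal_generated S = module.span (*) S"

text \<open>
  The minors of order \<open>CARD('p)\<close>. As \<open>'m\<close>, \<open>'q\<close> and \<open>'p\<close> carry no order, rows and columns are
  selected by arbitrary injections, so each minor occurs together with its negative (if
  \<open>CARD('p) \<ge> 2\<close>).
\<close>

definition minors :: "'p::finite itself \<Rightarrow> 'a::comm_ring_1 ^ 'q ^ 'm \<Rightarrow> 'a set" where
  "minors _ A = {d. \<exists>(r :: 'p \<Rightarrow> 'm) (c :: 'p \<Rightarrow> 'q). inj r \<and> inj c \<and>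
     d = det ((\<chi> a b. A $ r a $ c b) :: 'a ^ 'p ^ 'p)}"

lemma substitute_superset:
  assumes "finite T" "Poly_Mapping.keys p \<subseteq> T"
  shows "substitute F p x = (\<Sum>t\<in>T. Poly_Mapping.lookup p t *
       (\<Prod>v\<in>Poly_Mapping.keys t. F v x ^ Poly_Mapping.lookup t v))"
  unfolding substitute_def using assms
  by (intro sum.mono_neutral_left) (auto simp: in_keys_iff)

lemma substitute_single:
  "substitute F (Poly_Mapping.single t c) x =
     c * (\<Prod>v\<in>Poly_Mapping.keys t. F v x ^ Poly_Mapping.lookup t v)"
  by (simp add: substitute_def)

lemma substitute_const: "substitute F (Poly_Mapping.single 0 c) = (\<lambda>_. c)"
  by (rule ext) (simp add: substitute_single)

lemma substitute_indet: "substitute F (indet v) = F v"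
  by (rule ext) (simp add: substitute_single indet_def)

lemma substitute_add: "substitute F (p + q) = (\<lambda>x. substitute F p x + substitute F q x)"
proof
  fix x
  let ?T = "Poly_Mapping.keys p \<union> Poly_Mapping.keys q"
  have "Poly_Mapping.keys (p + q) \<subseteq> ?T"
    by (rule Poly_Mapping.keys_add)
  then show "substitute F (p + q) x = substitute F p x + substitute F q x"
    by (simp add: substitute_superset[of ?T] lookup_add distrib_right sum.distrib)
qed

lemma substitute_sum:
  "finite A \<Longrightarrow> substitute F (\<Sum>a\<in>A. f a) x = (\<Sum>a\<in>A. substitute F (f a) x)"
  by (induction A rule: finite_induct)
    (auto simp: substitute_add, simp add: substitute_def)

lemma monomial_expansion:
  "(\<Sum>t\<in>Poly_Mapping.keys p. Poly_Mapping.single t (Poly_Mapping.lookup p t)) = p"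
  by (rule poly_mapping_eqI)
    (simp add: lookup_sum lookup_single when_def in_keys_iff)

lemma substitute_mult: "substitute F (p * q) = (\<lambda>x. substitute F p x * substitute F q x)"
proof
  fix x
  let ?e = "\<lambda>t. \<Prod>v\<in>Poly_Mapping.keys t. F v x ^ Poly_Mapping.lookup t v"
  have e: "?e (s + t) = ?e s * ?e t" for s t
  proof -
    let ?T = "Poly_Mapping.keys s \<union> Poly_Mapping.keys t"
    have *: "?e u = (\<Prod>v\<in>?T. F v x ^ Poly_Mapping.lookup u v)"
      if "Poly_Mapping.keys u \<subseteq> ?T" for u
      using that by (intro prod.mono_neutral_left) (auto simp: in_keys_iff)
    have "?e (s + t) = (\<Prod>v\<in>?T. F v x ^ Poly_Mapping.lookup (s + t) v)"
      by (intro * Poly_Mapping.keys_add)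
    also have "\<dots> = ?e s * ?e t"
      by (simp only: *[of s, OF Un_upper1] *[of t, OF Un_upper2] lookup_add power_add prod.distrib)
    finally show ?thesis .
  qed
  have "substitute F (p * q) x =
      substitute F ((\<Sum>s\<in>Poly_Mapping.keys p. Poly_Mapping.single s (Poly_Mapping.lookup p s)) *
        (\<Sum>t\<in>Poly_Mapping.keys q. Poly_Mapping.single t (Poly_Mapping.lookup q t))) x"
    by (simp only: monomial_expansion)
  also have "\<dots> = substitute F p x * substitute F q x"
    unfolding sum_product
    by (simp add: substitute_sum mult_single substitute_single e)
      (simp add: substitute_def sum_product algebra_simps)
  finally show "substitute F (p * q) x = substitute F p x * substitute F q x" .
qed

end

theory Submission
  imports Defs
begin

text \<open>
  Write \<open>A\<close> for the \<open>m \<times> n\<close> matrix with rows \<open>u\<^sub>i\<close> and \<open>B\<close> for the \<open>n \<times> q\<close> matrix with columns \<open>\<xi>\<^sub>j\<close>,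
  so that \<open>(\<phi>\<^sub>i\<^sub>j) = A B\<close>. Both fundamental theorems rest on one combinatorial fact about a
  monomial \<open>M\<close> in the variables \<open>x\<^sub>i\<^sub>j\<close>. Call a set of positions \<open>(i, j)\<close> a chain if both coordinates
  increase strictly along it, and give \<open>x\<^sub>i\<^sub>j\<close> the weight \<open>(i + 1) (j + 1)\<close>, rows and columns being
  numbered from \<open>0\<close>.

  \<^emph>\<open>Spanning.\<close> By the rearrangement inequality the diagonal term of a minor with increasing rows and
  columns has strictly larger weight than its other terms (\<open>minor_led_by_diagonal\<close>). Hence,
  modulo the ideal \<open>I\<close> of the \<open>(n + 1)\<close>-minors, every polynomial is a combination of
  monomials without a chain of length \<open>n + 1\<close> (\<open>reduction\<close>).

  \<^emph>\<open>Independence.\<close> A monomial \<open>M\<close> without such a chain splits into \<open>n\<close> layers, each an antichain.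
  Replacing every \<open>x\<^sub>i\<^sub>j\<close> in the \<open>k\<close>-th layer by \<open>a\<^sub>i\<^sub>k b\<^sub>k\<^sub>j\<close> gives one term of the expansion of \<open>M(A B)\<close>. If
  that term occurs in \<open>M'(A B)\<close>, then \<open>M'\<close> also splits into \<open>n\<close> layers, with the same row and
  column sums as those of \<open>M\<close>. Among nonnegative integer matrices with prescribed row
  and column sums, one supported on an antichain is the unique one of least weight
  (\<open>quadrant_le_antichain\<close>, \<open>weight_minimal_unique\<close>). So \<open>M'\<close> is heavier than \<open>M\<close> or equal to it,
  and for \<open>M' = M\<close> the term arises exactly once, whatever the characteristic. Therefore a monomial
  of largest weight in a polynomial that vanishes on all products \<open>A B\<close> cannot be free of chains of
  length \<open>n + 1\<close> (\<open>coefficient_eq_0_of_layering\<close>). With the spanning statement this is the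
  second fundamental theorem.

  \<^emph>\<open>Invariants.\<close> Let \<open>\<delta>\<close> be the \<open>n\<close>-minor of the first \<open>n\<close> rows and the last \<open>n\<close> columns. Where it does not
  vanish, moving the first \<open>n\<close> vectors to the standard basis and applying Cramer's rule
  expresses an invariant \<open>f\<close> through the \<open>\<phi>\<^sub>i\<^sub>j\<close> with a power of \<open>\<delta>\<close> as denominator
  (\<open>invariant_times_power\<close>). To cancel one factor \<open>\<delta>\<close> from \<open>f \<delta>\<^sup>k = P(A B)\<close>, it suffices that a
  polynomial \<open>P\<close> satisfying \<open>P(A B) = 0\<close> whenever \<open>\<delta>(A B) = 0\<close> lies in \<open>I + (\<delta>)\<close>
  (\<open>vanishing_imp_in_ideal\<close>). This is again a spanning and independence argument. Let \<open>M\<close> contain no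
  chain of length \<open>n + 1\<close>. If it contains both a chain through the first \<open>n\<close> rows and one through the
  last \<open>n\<close> columns, then \<open>M\<close> can be reduced modulo \<open>I + (\<delta>)\<close> (\<open>two_chains_reducible\<close>). Otherwise \<open>M\<close> has a layering in which
  some layer avoids the first \<open>n\<close> rows, or one in which some layer avoids the last \<open>n\<close> columns; then
  the term of \<open>M\<close> used above survives when the corresponding column of the top block of \<open>A\<close>, or row
  of the last block of \<open>B\<close>, is set to zero, and this forces \<open>\<delta>(A B) = 0\<close>.
\<close>

section \<open>Weights of nonnegative integer matrices\<close>

text \<open>
  The row and column indices carry no order, so they are numbered arbitrarily.
\<close>

definition pos :: "'a::finite \<Rightarrow> nat" where
  "pos = to_nat_on UNIV"

definition elem_at :: "nat \<Rightarrow> 'a::finite" where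
  "elem_at = inv_into UNIV pos"

lemma bij_betw_pos: "bij_betw (pos :: 'a::finite \<Rightarrow> nat) UNIV {..<CARD('a)}"
  unfolding pos_def by (rule to_nat_on_finite) simp

lemma pos_less [simp]: "pos (x :: 'a::finite) < CARD('a)"
  using bij_betw_pos[where 'a = 'a] by (auto simp: bij_betw_def)

lemma pos_eq_iff [simp]: "pos x = pos y \<longleftrightarrow> x = y"
  using bij_betw_pos by (auto simp: bij_betw_def inj_on_def)

lemma pos_elem_at [simp]: "k < CARD('a) \<Longrightarrow> pos (elem_at k :: 'a::finite) = k"
  unfolding elem_at_def
  by (rule f_inv_into_f) (use bij_betw_pos[where 'a = 'a] in \<open>auto simp: bij_betw_def\<close>)

lemma elem_at_eq_iff:
  "a < CARD('a) \<Longrightarrow> b < CARD('a) \<Longrightarrow> (elem_at a :: 'a::finite) = elem_at b \<longleftrightarrow> a = b"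
  by (metis pos_elem_at)

definition southeast :: "'m::finite \<times> 'q::finite \<Rightarrow> 'm \<times> 'q \<Rightarrow> bool" where
  "southeast v w \<longleftrightarrow> pos (fst v) < pos (fst w) \<and> pos (snd v) < pos (snd w)"

lemma southeast_trans: "southeast u v \<Longrightarrow> southeast v w \<Longrightarrow> southeast u w"
  by (auto simp: southeast_def)

definition weight :: "('m::finite \<times> 'q::finite \<Rightarrow> nat) \<Rightarrow> nat" where
  "weight N = (\<Sum>v\<in>UNIV. N v * (Suc (pos (fst v)) * Suc (pos (snd v))))"

text \<open>
  Sums over lower right quadrants. They turn the weight, a product of row and column numbers, into a
  sum of quantities that can be compared one at a time; see \<open>weight_eq_sum_quadrant\<close>.
\<close>

definition quadrant :: "('m::finite \<times> 'q::finite \<Rightarrow> nat) \<Rightarrow> nat \<Rightarrow> nat \<Rightarrow> nat" where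
  "quadrant N s t = (\<Sum>v\<in>UNIV. N v * of_bool (s \<le> pos (fst v) \<and> t \<le> pos (snd v)))"

definition row_sum :: "('m \<times> 'q::finite \<Rightarrow> nat) \<Rightarrow> 'm \<Rightarrow> nat" where
  "row_sum N i = (\<Sum>j\<in>UNIV. N (i, j))"

definition col_sum :: "('m::finite \<times> 'q \<Rightarrow> nat) \<Rightarrow> 'q \<Rightarrow> nat" where
  "col_sum N j = (\<Sum>i\<in>UNIV. N (i, j))"

lemma weight_eq_sum_quadrant:
  fixes N :: "'m::finite \<times> 'q::finite \<Rightarrow> nat"
  shows "weight N = (\<Sum>s<CARD('m). \<Sum>t<CARD('q). quadrant N s t)"
proof -
  have count: "(\<Sum>s<n. of_bool (s \<le> k)) = Suc k" if "k < n" for k n :: nat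
  proof -
    have "{..<n} \<inter> {s. s \<le> k} = {..k}" using that by auto
    then show ?thesis by (simp add: sum.If_cases of_bool_def)
  qed
  have "(\<Sum>s<CARD('m). \<Sum>t<CARD('q). quadrant N s t) =
     (\<Sum>s<CARD('m). \<Sum>v\<in>UNIV. \<Sum>t<CARD('q). N v * of_bool (s \<le> pos (fst v) \<and> t \<le> pos (snd v)))"
    unfolding quadrant_def by (intro sum.cong refl sum.swap)
  also have "\<dots> = (\<Sum>v\<in>UNIV. \<Sum>s<CARD('m). \<Sum>t<CARD('q).
       N v * of_bool (s \<le> pos (fst v) \<and> t \<le> pos (snd v)))"
    by (rule sum.swap)
  also have "\<dots> = (\<Sum>v\<in>UNIV. N v * ((\<Sum>s<CARD('m). of_bool (s \<le> pos (fst v))) *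
       (\<Sum>t<CARD('q). of_bool (t \<le> pos (snd v)))))"
    unfolding sum_product of_bool_conj by (simp only: sum_distrib_left)
  also have "\<dots> = weight N"
    unfolding weight_def by (simp only: count pos_less)
  finally show ?thesis ..
qed

text \<open>
  Inclusion and exclusion over the four quadrants with corner at or next to a position isolates
  its entry.
\<close>

lemma quadrant_determines:
  fixes N D :: "'m::finite \<times> 'q::finite \<Rightarrow> nat"
  assumes "\<And>s t. quadrant N s t = quadrant D s t"
  shows "N = D"
proof
  fix v
  have *: "N v + (quadrant N (Suc (pos (fst v))) (pos (snd v)) + quadrant N (pos (fst v)) (Suc (pos (snd v))))
    = quadrant N (pos (fst v)) (pos (snd v)) + quadrant N (Suc (pos (fst v))) (Suc (pos (snd v)))"
    for N :: "'m \<times> 'q \<Rightarrow> nat"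
  proof -
    have "N v = (\<Sum>w\<in>UNIV. N w * of_bool (w = v))"
      by (subst sum.remove[of _ v]) auto
    then have "?thesis \<longleftrightarrow> (\<Sum>w\<in>UNIV. N w * of_bool (w = v)) +
        (quadrant N (Suc (pos (fst v))) (pos (snd v)) + quadrant N (pos (fst v)) (Suc (pos (snd v))))
      = quadrant N (pos (fst v)) (pos (snd v)) + quadrant N (Suc (pos (fst v))) (Suc (pos (snd v)))"
      by simp
    also have "\<dots>"
      unfolding quadrant_def sum.distrib[symmetric]
    proof (rule sum.cong)
      fix w :: "'m \<times> 'q"
      have "w = v \<longleftrightarrow> pos (fst w) = pos (fst v) \<and> pos (snd w) = pos (snd v)"
        by (auto simp: prod_eq_iff)
      then show "N w * of_bool (w = v) +
          (N w * of_bool (Suc (pos (fst v)) \<le> pos (fst w) \<and> pos (snd v) \<le> pos (snd w)) +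
           N w * of_bool (pos (fst v) \<le> pos (fst w) \<and> Suc (pos (snd v)) \<le> pos (snd w))) =
          N w * of_bool (pos (fst v) \<le> pos (fst w) \<and> pos (snd v) \<le> pos (snd w)) +
          N w * of_bool (Suc (pos (fst v)) \<le> pos (fst w) \<and> Suc (pos (snd v)) \<le> pos (snd w))"
        unfolding of_bool_def by (auto simp: Suc_le_eq le_less)
    qed simp
    finally show ?thesis by simp
  qed
  show "N v = D v"
    using *[of N] *[of D] assms by (metis add_right_imp_eq)
qed

lemma weight_mono:
  fixes N D :: "'m::finite \<times> 'q::finite \<Rightarrow> nat"
  assumes "\<And>s t. quadrant D s t \<le> quadrant N s t"
  shows "weight D \<le> weight N"
  unfolding weight_eq_sum_quadrant using assms by (intro sum_mono)

lemma weight_minimal_unique: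
  fixes N D :: "'m::finite \<times> 'q::finite \<Rightarrow> nat"
  assumes le: "\<And>s t. quadrant D s t \<le> quadrant N s t" and "weight N \<le> weight D"
  shows "N = D"
proof (rule quadrant_determines)
  fix s t
  show "quadrant N s t = quadrant D s t"
  proof (cases "s < CARD('m) \<and> t < CARD('q)")
    case True
    have eq: "(\<Sum>s<CARD('m). \<Sum>t<CARD('q). quadrant D s t) = (\<Sum>s<CARD('m). \<Sum>t<CARD('q). quadrant N s t)"
      using weight_mono[OF le] assms(2) unfolding weight_eq_sum_quadrant by simp
    have "(\<Sum>t<CARD('q). quadrant D s t) = (\<Sum>t<CARD('q). quadrant N s t)"
      by (rule sum_mono_inv[OF eq]) (use True le in \<open>auto intro: sum_mono\<close>)
    then have "quadrant D s t = quadrant N s t"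
      by (rule sum_mono_inv) (use True le in auto)
    then show ?thesis ..
  next
    case False
    have "(s \<le> pos i \<and> t \<le> pos j) = False" for i :: 'm and j :: 'q
      using False le_less_trans[OF _ pos_less[of i]] le_less_trans[OF _ pos_less[of j]] by blast
    then show ?thesis by (simp only: quadrant_def of_bool_eq mult_0_right)
  qed
qed

lemma sum_row_sum: "(\<Sum>v\<in>UNIV. N v * f (fst v)) = (\<Sum>i\<in>UNIV. row_sum N i * f i)"
  for N :: "'m::finite \<times> 'q::finite \<Rightarrow> nat"
  by (simp add: row_sum_def sum_distrib_right sum.cartesian_product split_def
      flip: UNIV_Times_UNIV)

lemma sum_col_sum: "(\<Sum>v\<in>UNIV. N v * f (snd v)) = (\<Sum>j\<in>UNIV. col_sum N j * f j)"
  for N :: "'m::finite \<times> 'q::finite \<Rightarrow> nat"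
proof -
  have "(\<Sum>j\<in>UNIV. col_sum N j * f j) = (\<Sum>i\<in>UNIV. \<Sum>j\<in>UNIV. N (i, j) * f j)"
    by (subst sum.swap) (simp add: col_sum_def sum_distrib_right)
  then show ?thesis
    by (simp add: sum.cartesian_product split_def flip: UNIV_Times_UNIV)
qed

text \<open>
  For fixed row and column sums, the sum over a lower right quadrant and that over the opposite
  quadrant differ by a constant. For an antichain one of the two is zero, so that both are
  as small as possible.
\<close>

lemma quadrant_le_antichain:
  fixes N D :: "'m::finite \<times> 'q::finite \<Rightarrow> nat"
  assumes rows: "\<And>i. row_sum N i = row_sum D i" and cols: "\<And>j. col_sum N j = col_sum D j"
    and antichain: "\<And>v w. D v \<noteq> 0 \<Longrightarrow> D w \<noteq> 0 \<Longrightarrow> \<not> southeast v w"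
  shows "quadrant D s t \<le> quadrant N s t"
proof -
  define R where "R = (\<Sum>i\<in>UNIV. row_sum D i * of_bool (s \<le> pos i))"
  define C where "C = (\<Sum>j\<in>UNIV. col_sum D j * of_bool (t \<le> pos j))"
  define T where "T = (\<Sum>i\<in>UNIV. row_sum D i * 1)"
  define G where "G = (\<lambda>N::'m \<times> 'q \<Rightarrow> nat.
    \<Sum>v\<in>UNIV. N v * of_bool (pos (fst v) < s \<and> pos (snd v) < t))"
  have *: "quadrant N s t + T = R + C + G N"
    if "\<And>i. row_sum N i = row_sum D i" and "\<And>j. col_sum N j = col_sum D j" for N
  proof -
    have "T = (\<Sum>v\<in>UNIV. N v * 1)" "R = (\<Sum>v\<in>UNIV. N v * of_bool (s \<le> pos (fst v)))"
        "C = (\<Sum>v\<in>UNIV. N v * of_bool (t \<le> pos (snd v)))"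
      unfolding T_def R_def C_def that[symmetric]
      using sum_row_sum[of N "\<lambda>_. 1"] sum_row_sum[of N "\<lambda>i. of_bool (s \<le> pos i)"]
        sum_col_sum[of N "\<lambda>j. of_bool (t \<le> pos j)"] by simp_all
    then show ?thesis
      unfolding G_def quadrant_def by (simp add: sum.distrib[symmetric] of_bool_def)
        (intro sum.cong refl, auto)
  qed
  show ?thesis
  proof (cases "quadrant D s t = 0")
    case False
    then obtain w where w: "D w \<noteq> 0" "s \<le> pos (fst w)" "t \<le> pos (snd w)"
      unfolding quadrant_def by (auto split: if_splits simp: of_bool_def)
    have "G D = 0"
      unfolding G_def
    proof (rule sum.neutral, rule ballI)
      fix v show "D v * of_bool (pos (fst v) < s \<and> pos (snd v) < t) = 0"
        using antichain[OF _ w(1), of v] w unfolding southeast_def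
        by (cases "D v = 0") (auto simp: of_bool_def)
    qed
    then show ?thesis using *[OF rows cols] *[of D] by simp
  qed simp
qed

text \<open>
  A quadrant sum is at most the sum of the rows, and at most the sum of the columns, that the quadrant
  meets. For a chain, one of these two bands is zero outside the quadrant, so that the bound is
  attained.
\<close>

lemma quadrant_ge_chain:
  fixes N D :: "'m::finite \<times> 'q::finite \<Rightarrow> nat"
  assumes rows: "\<And>i. row_sum N i = row_sum D i" and cols: "\<And>j. col_sum N j = col_sum D j"
    and chain: "\<And>v w. D v \<noteq> 0 \<Longrightarrow> D w \<noteq> 0 \<Longrightarrow> v = w \<or> southeast v w \<or> southeast w v"
  shows "quadrant N s t \<le> quadrant D s t"
proof -
  define R where "R = (\<lambda>N::'m \<times> 'q \<Rightarrow> nat. \<Sum>v\<in>UNIV. N v * of_bool (s \<le> pos (fst v)))"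
  define C where "C = (\<lambda>N::'m \<times> 'q \<Rightarrow> nat. \<Sum>v\<in>UNIV. N v * of_bool (t \<le> pos (snd v)))"
  have RC: "R N = R D" "C N = C D"
    unfolding R_def C_def
    by (simp_all only: sum_row_sum[of _ "\<lambda>i. of_bool (s \<le> pos i)"]
      sum_col_sum[of _ "\<lambda>i. of_bool (t \<le> pos i)"] rows cols)
  have "quadrant N s t \<le> R N" "quadrant N s t \<le> C N"
    unfolding quadrant_def R_def C_def by (auto intro!: sum_mono simp: of_bool_def)
  moreover have "quadrant D s t = R D \<or> quadrant D s t = C D"
  proof (cases "\<exists>v. D v \<noteq> 0 \<and> s \<le> pos (fst v) \<and> pos (snd v) < t")
    case True
    then obtain v where v: "D v \<noteq> 0" "s \<le> pos (fst v)" "pos (snd v) < t" by blast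
    have "quadrant D s t = C D"
      unfolding quadrant_def C_def
    proof (rule sum.cong)
      fix w
      show "D w * of_bool (s \<le> pos (fst w) \<and> t \<le> pos (snd w)) = D w * of_bool (t \<le> pos (snd w))"
        using chain[of v w] v by (cases "D w = 0") (auto simp: southeast_def of_bool_def)
    qed simp
    then show ?thesis ..
  next
    case False
    have "quadrant D s t = R D"
      unfolding quadrant_def R_def
    proof (rule sum.cong)
      fix w
      have "D w = 0 \<or> \<not> s \<le> pos (fst w) \<or> t \<le> pos (snd w)"
        using False not_le by blast
      then show "D w * of_bool (s \<le> pos (fst w) \<and> t \<le> pos (snd w)) = D w * of_bool (s \<le> pos (fst w))"
        by auto
    qed simp
    then show ?thesis ..
  qed
  ultimately show ?thesis using RC by auto
qed

section \<open>Extracting coefficients from a vanishing polynomial\<close>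

text \<open>
  Distinct monomials are linearly independent as functions over an infinite field, also when the
  variables outside \<open>T\<close> are set to zero. Several indices \<open>h\<close> may carry the same exponents, which is
  why a sum of coefficients vanishes and not each of them. One variable is removed at a time: its
  powers are separated by viewing the function as a polynomial in it.
\<close>

lemma monomial_functions_independent:
  fixes c :: "'h \<Rightarrow> 'k::field" and E :: "'h \<Rightarrow> 'w \<Rightarrow> nat"
  assumes inf: "infinite (UNIV :: 'k set)" and "finite W" "finite H"
    and supp: "\<And>w. w \<notin> T \<Longrightarrow> e w = 0"
    and zero: "\<And>x. (\<And>w. w \<notin> T \<Longrightarrow> x w = 0) \<Longrightarrow> (\<Sum>h\<in>H. c h * (\<Prod>w\<in>W. x w ^ E h w)) = 0"
  shows "(\<Sum>h | h \<in> H \<and> (\<forall>w\<in>W. E h w = e w). c h) = 0"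
  using \<open>finite W\<close> \<open>finite H\<close> zero
proof (induction W arbitrary: H rule: finite_induct)
  case empty
  from empty.prems(2)[of "\<lambda>_. 0"] show ?case by simp
next
  case (insert w W)
  let ?H = "{h \<in> H. E h w = e w}"
  have zero: "(\<Sum>h\<in>?H. c h * (\<Prod>u\<in>W. x u ^ E h u)) = 0" if x: "\<And>w. w \<notin> T \<Longrightarrow> x w = 0" for x
  proof -
    define m where "m h = c h * (\<Prod>u\<in>W. x u ^ E h u)" for h
    have upd: "(\<Sum>h\<in>H. m h * y ^ E h w) = 0" if "w \<notin> T \<Longrightarrow> y = 0" for y
    proof -
      have "(\<Sum>h\<in>H. c h * (\<Prod>u\<in>insert w W. (x(w := y)) u ^ E h u)) = 0"
        by (rule insert.prems(2)) (use x that in auto)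
      moreover have "(\<Prod>u\<in>insert w W. (x(w := y)) u ^ E h u) = y ^ E h w * (\<Prod>u\<in>W. x u ^ E h u)" for h
      proof -
        have "(\<Prod>u\<in>W. (x(w := y)) u ^ E h u) = (\<Prod>u\<in>W. x u ^ E h u)"
          using insert.hyps by (intro prod.cong) auto
        then show ?thesis using insert.hyps by simp
      qed
      ultimately show ?thesis by (simp add: m_def mult_ac)
    qed
    have "(\<Sum>h\<in>H. if E h w = e w then m h else 0) = 0"
    proof (cases "w \<in> T")
      case True
      \<comment> \<open>The values \<open>upd\<close> at all \<open>y\<close> say that this polynomial in the variable \<open>w\<close> is zero.\<close>
      define p where "p = (\<Sum>h\<in>H. monom (m h) (E h w))"
      have "poly p y = 0" for y
        using upd[of y] True by (simp add: p_def poly_sum poly_monom)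
      then have "p = 0"
        using poly_roots_finite[of p] inf by auto
      then have "coeff p (e w) = 0" by simp
      then show ?thesis
        by (simp add: p_def coeff_sum if_distrib cong: if_cong)
    next
      case False
      have "m h * 0 ^ E h w = (if E h w = e w then m h else 0)" for h
        using supp[OF False] by simp
      then show ?thesis using upd[of 0] by simp
    qed
    then show ?thesis
      using insert.prems(1) by (simp only: m_def sum.inter_filter)
  qed
  have "{h \<in> H. \<forall>u\<in>insert w W. E h u = e u} = {h \<in> ?H. \<forall>u\<in>W. E h u = e u}"
    by auto
  then show ?case
    using insert.IH[of ?H, OF _ zero] insert.prems(1) by simp
qed

lemma power_sum_expansion:
  fixes z :: "'n::finite \<Rightarrow> 'k::comm_semiring_1"
  shows "(\<Sum>k\<in>UNIV. z k) ^ e =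
    (\<Sum>h\<in>PiE {..<e} (\<lambda>_. UNIV). \<Prod>k\<in>UNIV. z k ^ card {c \<in> {..<e}. h c = k})"
proof -
  have "(\<Sum>k\<in>UNIV. z k) ^ e = (\<Prod>c<e. \<Sum>k\<in>UNIV. z k)"
    by simp
  also have "\<dots> = (\<Sum>h\<in>PiE {..<e} (\<lambda>_. UNIV). \<Prod>c<e. z (h c))"
    by (subst prod_sum_PiE) auto
  also have "(\<lambda>h. \<Prod>c<e. z (h c)) = (\<lambda>h. \<Prod>k\<in>UNIV. z k ^ card {c \<in> {..<e}. h c = k})"
  proof
    fix h
    have "(\<Prod>c<e. z (h c)) = (\<Prod>k\<in>UNIV. \<Prod>c | c \<in> {..<e} \<and> h c = k. z (h c))"
      by (rule prod.group[symmetric]) auto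
    also have "\<dots> = (\<Prod>k\<in>UNIV. z k ^ card {c \<in> {..<e}. h c = k})"
      by (intro prod.cong refl) simp
    finally show "(\<Prod>c<e. z (h c)) = (\<Prod>k\<in>UNIV. z k ^ card {c \<in> {..<e}. h c = k})" .
  qed
  finally show ?thesis .
qed

text \<open>
  A layering assigns to each of the \<open>e v\<close> copies of the variable \<open>v\<close> one of the \<open>n\<close> summands of
  \<open>\<Sum>k. a\<^sub>i\<^sub>k b\<^sub>k\<^sub>j\<close>; thus layerings index the terms in the expansion of a monomial evaluated at \<open>A B\<close>. Counting
  them one by one avoids multinomial coefficients, which could vanish in the field.
\<close>

definition layerings :: "('v \<Rightarrow> nat) \<Rightarrow> ('v \<Rightarrow> nat \<Rightarrow> 'n) set" where
  "layerings e = PiE UNIV (\<lambda>v. PiE {..<e v} (\<lambda>_. UNIV))"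

definition layer_count :: "('v \<Rightarrow> nat) \<Rightarrow> ('v \<Rightarrow> nat \<Rightarrow> 'n) \<Rightarrow> 'n \<Rightarrow> 'v \<Rightarrow> nat" where
  "layer_count e h k v = card {c \<in> {..<e v}. h v c = k}"

lemma finite_layerings: "finite (layerings e :: ('v::finite \<Rightarrow> nat \<Rightarrow> 'n::finite) set)"
  unfolding layerings_def by (intro finite_PiE) auto

lemma sum_layer_count: "(\<Sum>k\<in>UNIV. layer_count e h (k :: 'n::finite) v) = e v"
proof -
  have "(\<Sum>k\<in>UNIV. \<Sum>c | c \<in> {..<e v} \<and> h v c = k. 1) = (\<Sum>c<e v. 1 :: nat)"
    by (rule sum.group) auto
  then show ?thesis by (simp add: layer_count_def)
qed

text \<open>
  The exponents of \<open>a\<^sub>i\<^sub>k\<close> and \<open>b\<^sub>k\<^sub>j\<close> in the term that belongs to layers \<open>N k\<close>.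
\<close>

definition margins ::
  "('n \<Rightarrow> 'm::finite \<times> 'q::finite \<Rightarrow> nat) \<Rightarrow> ('m \<times> 'n) + ('n \<times> 'q) \<Rightarrow> nat" where
  "margins N w = (case w of Inl (i, k) \<Rightarrow> row_sum (N k) i | Inr (k, j) \<Rightarrow> col_sum (N k) j)"

lemma prod_row_sum: "(\<Prod>v\<in>UNIV. f (fst v) ^ N v) = (\<Prod>i\<in>UNIV. (f i :: 'k::comm_semiring_1) ^ row_sum N i)"
  for N :: "'m::finite \<times> 'q::finite \<Rightarrow> nat"
  by (simp add: row_sum_def power_sum prod.cartesian_product split_def flip: UNIV_Times_UNIV)

lemma prod_col_sum: "(\<Prod>v\<in>UNIV. f (snd v) ^ N v) = (\<Prod>j\<in>UNIV. (f j :: 'k::comm_semiring_1) ^ col_sum N j)"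
  for N :: "'m::finite \<times> 'q::finite \<Rightarrow> nat"
proof -
  have "(\<Prod>j\<in>UNIV. f j ^ col_sum N j) = (\<Prod>i\<in>UNIV. \<Prod>j\<in>UNIV. f j ^ N (i, j))"
    by (subst prod.swap) (simp add: col_sum_def power_sum)
  then show ?thesis
    by (simp add: prod.cartesian_product split_def flip: UNIV_Times_UNIV)
qed

lemma prod_margins:
  fixes y :: "('m::finite \<times> 'n::finite) + ('n \<times> 'q::finite) \<Rightarrow> 'k::comm_semiring_1"
  shows "(\<Prod>v\<in>UNIV. \<Prod>k\<in>UNIV. (y (Inl (fst v, k)) * y (Inr (k, snd v))) ^ N k v) =
    (\<Prod>w\<in>UNIV. y w ^ margins N w)"
proof -
  have l: "(\<Prod>v\<in>UNIV. \<Prod>k\<in>UNIV. y (Inl (fst v, k)) ^ N k v) = (\<Prod>w\<in>UNIV. y (Inl w) ^ margins N (Inl w))"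
  proof -
    have "(\<Prod>v\<in>UNIV. \<Prod>k\<in>UNIV. y (Inl (fst v, k)) ^ N k v) =
        (\<Prod>k\<in>UNIV. \<Prod>i\<in>UNIV. y (Inl (i, k)) ^ row_sum (N k) i)"
      by (subst prod.swap) (intro prod.cong refl prod_row_sum)
    also have "\<dots> = (\<Prod>i\<in>UNIV. \<Prod>k\<in>UNIV. y (Inl (i, k)) ^ row_sum (N k) i)"
      by (rule prod.swap)
    finally show ?thesis
      by (simp add: margins_def prod.cartesian_product split_def flip: UNIV_Times_UNIV)
  qed
  have r: "(\<Prod>v\<in>UNIV. \<Prod>k\<in>UNIV. y (Inr (k, snd v)) ^ N k v) = (\<Prod>w\<in>UNIV. y (Inr w) ^ margins N (Inr w))"
  proof -
    have "(\<Prod>v\<in>UNIV. \<Prod>k\<in>UNIV. y (Inr (k, snd v)) ^ N k v) =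
        (\<Prod>k\<in>UNIV. \<Prod>j\<in>UNIV. y (Inr (k, j)) ^ col_sum (N k) j)"
      by (subst prod.swap) (intro prod.cong refl prod_col_sum)
    then show ?thesis
      by (simp add: margins_def prod.cartesian_product split_def flip: UNIV_Times_UNIV)
  qed
  have "(\<Prod>w\<in>UNIV. y w ^ margins N w) =
      (\<Prod>w\<in>UNIV. y (Inl w) ^ margins N (Inl w)) * (\<Prod>w\<in>UNIV. y (Inr w) ^ margins N (Inr w))"
    by (simp add: prod.Plus flip: UNIV_Plus_UNIV)
  then show ?thesis
    by (simp only: l[symmetric] r[symmetric] power_mult_distrib prod.distrib)
qed

lemma monomial_expansion_layerings:
  fixes y :: "('m::finite \<times> 'n::finite) + ('n \<times> 'q::finite) \<Rightarrow> 'k::comm_semiring_1"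
  shows "(\<Prod>v\<in>UNIV. (\<Sum>k\<in>UNIV. y (Inl (fst v, k)) * y (Inr (k, snd v))) ^ e v) =
    (\<Sum>h\<in>layerings e. \<Prod>w\<in>UNIV. y w ^ margins (layer_count e h) w)"
  unfolding layerings_def power_sum_expansion
  by (subst prod_sum_PiE)
    (auto intro!: finite_PiE simp: prod_margins[symmetric] layer_count_def)

lemma weight_sum: "weight (\<lambda>v. \<Sum>k\<in>A. N k v) = (\<Sum>k\<in>A. weight (N k))"
  unfolding weight_def sum_distrib_right by (rule sum.swap)

text \<open>
  The rearrangement inequality, applied to every layer: among all families of layers with the
  margins of a family of antichains, that family alone has the least total weight.
\<close>

lemma layers_unique:
  fixes N D :: "'n::finite \<Rightarrow> 'm::finite \<times> 'q::finite \<Rightarrow> nat"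
  assumes margins: "margins N = margins D"
    and antichain: "\<And>k v w. D k v \<noteq> 0 \<Longrightarrow> D k w \<noteq> 0 \<Longrightarrow> \<not> southeast v w"
    and weight: "weight (\<lambda>v. \<Sum>k\<in>UNIV. N k v) \<le> weight (\<lambda>v. \<Sum>k\<in>UNIV. D k v)"
  shows "N = D"
proof
  fix k
  have rows: "row_sum (N k) i = row_sum (D k) i" for k i
    using fun_cong[OF margins, of "Inl (i, k)"] by (simp add: margins_def)
  have cols: "col_sum (N k) j = col_sum (D k) j" for k j
    using fun_cong[OF margins, of "Inr (k, j)"] by (simp add: margins_def)
  have le: "quadrant (D k) s t \<le> quadrant (N k) s t" for k s t
    using rows cols antichain by (rule quadrant_le_antichain)
  have "(\<Sum>k\<in>UNIV. weight (D k)) = (\<Sum>k\<in>UNIV. weight (N k))"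
    using weight unfolding weight_sum by (auto intro!: antisym sum_mono weight_mono le)
  then have "weight (D k) = weight (N k)"
    by (rule sum_mono_inv) (auto intro: weight_mono le)
  then show "N k = D k"
    by (intro weight_minimal_unique le) simp
qed

section \<open>Monomials on matrices of bounded rank\<close>

text \<open>
  The point of \<open>X\<close> with given matrix entries \<open>a\<^sub>i\<^sub>k\<close> (left summand) and \<open>b\<^sub>k\<^sub>j\<close> (right summand).
\<close>

definition point ::
  "(('m \<times> 'n::finite) + ('n \<times> 'q) \<Rightarrow> 'k::field) \<Rightarrow> ('k, 'n, 'm, 'q) space" where
  "point y = (\<lambda>i. \<chi> k. y (Inl (i, k)), \<lambda>j. Dual (\<lambda>v. \<Sum>k\<in>UNIV. y (Inr (k, j)) * v $ k))"

lemma fst_point [simp]: "fst (point y) i $ k = y (Inl (i, k))"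
  by (simp add: point_def)

lemma dual_apply_point: "dual_apply (snd (point y) j) v = (\<Sum>k\<in>UNIV. y (Inr (k, j)) * v $ k)"
proof -
  have "Vector_Spaces.linear (*s) (*) (\<lambda>v. \<Sum>k\<in>UNIV. y (Inr (k, j)) * v $ k)"
    by (simp add: Vector_Spaces.linear_iff vector_space_def algebra_simps sum.distrib sum_distrib_left)
  then show ?thesis by (simp add: point_def Dual_inverse)
qed

lemma dual_apply_point_axis [simp]: "dual_apply (snd (point y) j) (axis k 1) = y (Inr (k, j))"
  by (simp add: dual_apply_point axis_def if_distrib cong: if_cong)

lemma phi_point: "\<phi> i j (point y) = (\<Sum>k\<in>UNIV. y (Inl (i, k)) * y (Inr (k, j)))"
  by (simp add: \<phi>_def dual_apply_point mult.commute)

text \<open>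
  The comorphism of \<open>(A, B) \<mapsto> A B\<close>.
\<close>

abbreviation pullback ::
  "('m \<times> 'q, 'k) mpoly \<Rightarrow> ('k::field, 'n::finite, 'm, 'q) space \<Rightarrow> 'k" where
  "pullback \<equiv> substitute (\<lambda>(i, j). \<phi> i j)"

lemma substitute_UNIV:
  fixes p :: "('v::finite, 'k::comm_ring_1) mpoly"
  shows "substitute F p x = (\<Sum>t\<in>Poly_Mapping.keys p. Poly_Mapping.lookup p t *
    (\<Prod>v\<in>UNIV. F v x ^ Poly_Mapping.lookup t v))"
  unfolding substitute_def
  by (intro sum.cong refl arg_cong2[where f = "(*)"] prod.mono_neutral_left) (auto simp: in_keys_iff)

text \<open>
  The independence argument. The points \<open>x\<close> in the last hypothesis are those at which only the
  variables \<open>a\<^sub>i\<^sub>k\<close> and \<open>b\<^sub>k\<^sub>j\<close> in the distinguished term of \<open>t\<close> may be nonzero; the freedom to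
  test on such special points is what the proof of the first fundamental theorem needs. By \<open>layers_unique\<close> and the maximality of \<open>t\<close>, the distinguished term
  arises in the expansion of \<open>p\<close> from \<open>t\<close> alone and in one way, so its coefficient is that of \<open>t\<close> in
  \<open>p\<close>.
\<close>

lemma coefficient_eq_0_of_layering:
  fixes p :: "('m::finite \<times> 'q::finite, 'k::field) mpoly" and layer :: "'m \<times> 'q \<Rightarrow> 'n::finite"
  assumes inf: "infinite (UNIV :: 'k set)"
    and max: "\<And>t'. t' \<in> Poly_Mapping.keys p \<Longrightarrow>
      weight (Poly_Mapping.lookup t') \<le> weight (Poly_Mapping.lookup t)"
    and antichain: "\<And>v w. v \<in> Poly_Mapping.keys t \<Longrightarrow> w \<in> Poly_Mapping.keys t \<Longrightarrow>
      southeast v w \<Longrightarrow> layer v \<noteq> layer w"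
    and vanish: "\<And>x :: ('k, 'n, 'm, 'q) space.
      (\<And>i k. fst x i $ k \<noteq> 0 \<Longrightarrow> \<exists>j. (i, j) \<in> Poly_Mapping.keys t \<and> layer (i, j) = k) \<Longrightarrow>
      (\<And>j k. dual_apply (snd x j) (axis k 1) \<noteq> 0 \<Longrightarrow> \<exists>i. (i, j) \<in> Poly_Mapping.keys t \<and> layer (i, j) = k) \<Longrightarrow>
      pullback p x = 0"
  shows "t \<notin> Poly_Mapping.keys p"
proof
  assume t: "t \<in> Poly_Mapping.keys p"
  let ?lk = "Poly_Mapping.lookup"
  \<comment> \<open>\<open>D\<close> describes the layers of \<open>t\<close>, and \<open>S\<close> the pairs of a monomial of \<open>p\<close> and a layering of it that
    contribute to the distinguished term.\<close>
  define D where "D k v = (if layer v = k then ?lk t v else 0)" for k v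
  define H where "H = (SIGMA t':Poly_Mapping.keys p.
    (layerings (?lk t') :: ('m \<times> 'q \<Rightarrow> nat \<Rightarrow> 'n) set))"
  define E where "E = (\<lambda>(t', h :: 'm \<times> 'q \<Rightarrow> nat \<Rightarrow> 'n). margins (layer_count (?lk t') h))"
  define S where "S = {z. z \<in> H \<and> (\<forall>w\<in>UNIV. E z w = margins D w)}"
  define h0 where "h0 v = (\<lambda>c\<in>{..<?lk t v}. layer v)" for v
  have "(\<Sum>z\<in>S. ?lk p (fst z)) = 0"
    unfolding S_def
  proof (rule monomial_functions_independent[OF inf, where T = "{w. margins D w \<noteq> 0}"])
    show "finite H" unfolding H_def by (intro finite_SigmaI finite_layerings) auto
    fix y :: "('m \<times> 'n) + ('n \<times> 'q) \<Rightarrow> 'k"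
    assume y: "\<And>w. w \<notin> {w. margins D w \<noteq> 0} \<Longrightarrow> y w = 0"
    have "pullback p (point y) = 0"
    proof (rule vanish)
      fix i k assume "fst (point y) i $ k \<noteq> 0"
      then have "margins D (Inl (i, k)) \<noteq> 0" using y[of "Inl (i, k)"] by auto
      then obtain j where "D k (i, j) \<noteq> 0"
        unfolding margins_def row_sum_def by (auto elim: sum.not_neutral_contains_not_neutral)
      then show "\<exists>j. (i, j) \<in> Poly_Mapping.keys t \<and> layer (i, j) = k"
        by (auto simp: D_def in_keys_iff split: if_splits)
    next
      fix j k assume "dual_apply (snd (point y) j) (axis k 1) \<noteq> 0"
      then have "margins D (Inr (k, j)) \<noteq> 0" using y[of "Inr (k, j)"] by auto
      then obtain i where "D k (i, j) \<noteq> 0"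
        unfolding margins_def col_sum_def by (auto elim: sum.not_neutral_contains_not_neutral)
      then show "\<exists>i. (i, j) \<in> Poly_Mapping.keys t \<and> layer (i, j) = k"
        by (auto simp: D_def in_keys_iff split: if_splits)
    qed
    also have "pullback p (point y) = (\<Sum>t'\<in>Poly_Mapping.keys p. ?lk p t' *
        (\<Prod>v\<in>UNIV. (\<Sum>k\<in>UNIV. y (Inl (fst v, k)) * y (Inr (k, snd v))) ^ ?lk t' v))"
      by (simp add: substitute_UNIV split_def phi_point)
    also have "\<dots> = (\<Sum>t'\<in>Poly_Mapping.keys p. \<Sum>h\<in>layerings (?lk t').
        ?lk p t' * (\<Prod>w\<in>UNIV. y w ^ margins (layer_count (?lk t') h) w))"
      by (simp only: monomial_expansion_layerings sum_distrib_left)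
    also have "\<dots> = (\<Sum>z\<in>H. ?lk p (fst z) * (\<Prod>w\<in>UNIV. y w ^ E z w))"
      unfolding H_def E_def by (subst sum.Sigma) (auto simp: finite_layerings split_def)
    finally show "(\<Sum>z\<in>H. ?lk p (fst z) * (\<Prod>w\<in>UNIV. y w ^ E z w)) = 0" .
  qed auto
  moreover have "S = {(t, h0)}"
  proof -
    have sumD: "(\<Sum>k\<in>UNIV. D k v) = ?lk t v" for v
      by (simp add: D_def)
    have D0: "layer_count (?lk t) h0 = D"
      by (intro ext) (auto simp: layer_count_def h0_def D_def)
    have "(t, h0) \<in> S"
      using t by (auto simp: S_def H_def E_def D0 layerings_def h0_def split: if_splits)
    moreover have "z = (t, h0)" if z: "z \<in> S" for z
    proof -
      obtain t' h where [simp]: "z = (t', h)" by (cases z)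
      let ?N = "layer_count (?lk t') h"
      have t': "t' \<in> Poly_Mapping.keys p" and h: "h \<in> layerings (?lk t')" and "margins ?N = margins D"
        using z by (auto simp: S_def H_def E_def)
      then have N: "?N = D"
      proof (intro layers_unique)
        show "weight (\<lambda>v. \<Sum>k\<in>UNIV. ?N k v) \<le> weight (\<lambda>v. \<Sum>k\<in>UNIV. D k v)"
          using max[OF t'] by (simp add: sumD sum_layer_count)
        show "\<not> southeast v w" if "D k v \<noteq> 0" "D k w \<noteq> 0" for k v w
          using that antichain[of v w] by (auto simp: D_def in_keys_iff split: if_splits)
      qed
      have "?lk t' v = ?lk t v" for v
        using sum_layer_count[of "?lk t'" h v] sumD[of v] by (simp add: N)
      then have [simp]: "t' = t" by (rule poly_mapping_eqI)
      have "h v = h0 v" for v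
      proof
        fix c
        show "h v c = h0 v c"
        proof (cases "c < ?lk t v")
          case True
          have "card {c \<in> {..<?lk t v}. h v c = layer v} = card {..<?lk t v}"
            using fun_cong[OF fun_cong[OF N], of "layer v" v] by (simp add: layer_count_def D_def)
          then have "{c \<in> {..<?lk t v}. h v c = layer v} = {..<?lk t v}"
            by (intro card_subset_eq) auto
          then show ?thesis using True by (auto simp: h0_def)
        next
          case False
          then show ?thesis
            using h by (cases v) (auto simp: layerings_def h0_def PiE_def Pi_def extensional_def)
        qed
      qed
      then show ?thesis by auto
    qed
    ultimately show ?thesis by blast
  qed
  ultimately show False using t by (simp add: in_keys_iff)
qed

section \<open>Reduction modulo an ideal\<close>

text \<open>
  The facts about spans are specialised to ideals one by one: a global interpretation would declare
  the associativity law of scalar multiplication as a rewrite rule, which does not terminate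
  together with that of multiplication.
\<close>

lemma module_mult: "module ((*) :: 'a::comm_ring_1 \<Rightarrow> 'a \<Rightarrow> 'a)"
  by unfold_locales (auto simp: algebra_simps)

lemmas ideal_zero = module.span_zero[OF module_mult, folded ideal_generated_def]
lemmas ideal_base = module.span_base[OF module_mult, folded ideal_generated_def]
lemmas ideal_add = module.span_add[OF module_mult, folded ideal_generated_def]
lemmas ideal_mult = module.span_scale[OF module_mult, folded ideal_generated_def]
lemmas ideal_insert = module.span_insert[OF module_mult, folded ideal_generated_def]
lemmas ideal_induct = module.span_induct_alt[OF module_mult, folded ideal_generated_def,
    consumes 1, case_names base step]

abbreviation exponent_weight :: "('m::finite \<times> 'q::finite \<Rightarrow>\<^sub>0 nat) \<Rightarrow> nat" where
  "exponent_weight t \<equiv> weight (Poly_Mapping.lookup t)"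

lemma weight_add: "exponent_weight (s + t) = exponent_weight s + exponent_weight t"
  by (simp add: weight_def lookup_add sum.distrib distrib_right)

text \<open>
  A substitute for leading monomials. The weight is not a total order on monomials, hence the
  requirement that all other monomials are strictly lighter.
\<close>

definition led_by :: "('m::finite \<times> 'q::finite, 'k::comm_ring_1) mpoly \<Rightarrow> ('m \<times> 'q \<Rightarrow>\<^sub>0 nat) \<Rightarrow> bool" where
  "led_by g t \<longleftrightarrow> (\<exists>r. g = Poly_Mapping.single t 1 + r \<and>
     (\<forall>t'\<in>Poly_Mapping.keys r. exponent_weight t' < exponent_weight t))"

lemma led_by_single: "led_by (Poly_Mapping.single t 1) t"
  unfolding led_by_def by (intro exI[of _ 0]) auto

lemma led_by_mult:
  assumes "led_by g s" "led_by h t"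
  shows "led_by (g * h) (s + t)"
proof -
  obtain a where a: "g = Poly_Mapping.single s 1 + a"
    "\<And>t'. t' \<in> Poly_Mapping.keys a \<Longrightarrow> exponent_weight t' < exponent_weight s"
    using assms(1) unfolding led_by_def by blast
  obtain b where b: "h = Poly_Mapping.single t 1 + b"
    "\<And>t'. t' \<in> Poly_Mapping.keys b \<Longrightarrow> exponent_weight t' < exponent_weight t"
    using assms(2) unfolding led_by_def by blast
  let ?s = "Poly_Mapping.single s 1" and ?t = "Poly_Mapping.single t 1"
  have eq: "g * h = Poly_Mapping.single (s + t) 1 + (?s * b + a * ?t + a * b)"
    by (simp add: a b algebra_simps mult_single)
  have "Poly_Mapping.keys (?s * b + a * ?t + a * b) \<subseteq>
      Poly_Mapping.keys (?s * b) \<union> Poly_Mapping.keys (a * ?t) \<union> Poly_Mapping.keys (a * b)"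
    using Poly_Mapping.keys_add[of "?s * b + a * ?t" "a * b"]
      Poly_Mapping.keys_add[of "?s * b" "a * ?t"] by blast
  also have "\<dots> \<subseteq> {u. exponent_weight u < exponent_weight (s + t)}"
    using keys_mult[of ?s b] keys_mult[of a ?t] keys_mult[of a b]
    by (fastforce simp: weight_add split: if_splits dest: a(2) b(2) intro: add_strict_mono)
  finally show ?thesis
    unfolding led_by_def eq by blast
qed

lemma led_by_sum:
  assumes "finite A" "a \<in> A" "f a = Poly_Mapping.single t 1"
    and "\<And>b t'. b \<in> A \<Longrightarrow> b \<noteq> a \<Longrightarrow> t' \<in> Poly_Mapping.keys (f b) \<Longrightarrow> exponent_weight t' < exponent_weight t"
  shows "led_by (\<Sum>b\<in>A. f b) t"
  unfolding led_by_def
proof (intro exI[of _ "\<Sum>b\<in>A - {a}. f b"] conjI ballI)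
  show "(\<Sum>b\<in>A. f b) = Poly_Mapping.single t 1 + (\<Sum>b\<in>A - {a}. f b)"
    using assms(1-3) by (simp add: sum.remove)
  show "exponent_weight t' < exponent_weight t" if "t' \<in> Poly_Mapping.keys (\<Sum>b\<in>A - {a}. f b)" for t'
    using that Poly_Mapping.keys_sum[of f "A - {a}"] assms(4) by auto
qed

text \<open>
  Division with remainder by the weight: a monomial that leads an element of the ideal is replaced by
  lighter ones, and weights are natural numbers.
\<close>

lemma reduction:
  fixes p :: "('m::finite \<times> 'q::finite, 'k::field) mpoly"
  obtains r where "p - r \<in> ideal_generated S"
    and "\<And>t g. t \<in> Poly_Mapping.keys r \<Longrightarrow> g \<in> ideal_generated S \<Longrightarrow> \<not> led_by g t"
proof -
  define reducible where "reducible p \<longleftrightarrow> (\<exists>r. p - r \<in> ideal_generated S \<and>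
      (\<forall>t\<in>Poly_Mapping.keys r. \<forall>g\<in>ideal_generated S. \<not> led_by g t))"
    for p :: "('m \<times> 'q, 'k) mpoly"
  have add: "reducible (p + p')" if pp: "reducible p" "reducible p'" for p p'
  proof -
    obtain r r' where r: "p - r \<in> ideal_generated S" "p' - r' \<in> ideal_generated S"
      "\<forall>t\<in>Poly_Mapping.keys r. \<forall>g\<in>ideal_generated S. \<not> led_by g t"
      "\<forall>t\<in>Poly_Mapping.keys r'. \<forall>g\<in>ideal_generated S. \<not> led_by g t"
      using pp unfolding reducible_def by blast
    have "p + p' - (r + r') = (p - r) + (p' - r')" by simp
    then have "p + p' - (r + r') \<in> ideal_generated S"
      using r(1,2) ideal_add by metis
    then show ?thesis
      unfolding reducible_def using r(3,4) Poly_Mapping.keys_add[of r r'] by blast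
  qed
  have sum: "reducible p" if single: "\<And>t c. t \<in> Poly_Mapping.keys p \<Longrightarrow> reducible (Poly_Mapping.single t c)" for p
  proof -
    have zero: "reducible 0"
      unfolding reducible_def by (intro exI[of _ 0]) (auto intro: ideal_zero)
    have "reducible (\<Sum>t\<in>A. Poly_Mapping.single t (Poly_Mapping.lookup p t))"
      if "A \<subseteq> Poly_Mapping.keys p" for A
      using finite_subset[OF that finite_keys] that
      by (induction A rule: finite_induct) (auto intro: zero add single)
    from this[OF order_refl] show ?thesis by (simp add: monomial_expansion)
  qed
  have "reducible (Poly_Mapping.single t c)" for t c
  proof (induction "exponent_weight t" arbitrary: t c rule: less_induct)
    case less
    show ?case
    proof (cases "\<exists>g\<in>ideal_generated S. led_by g t")
      case True
      then obtain g r where g: "g \<in> ideal_generated S" "g = Poly_Mapping.single t 1 + r"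
        "\<And>t'. t' \<in> Poly_Mapping.keys r \<Longrightarrow> exponent_weight t' < exponent_weight t"
        unfolding led_by_def by blast
      let ?c = "Poly_Mapping.single 0 c"
      \<comment> \<open>Modulo the ideal, the monomial \<open>t\<close> equals \<open>- r\<close>, which is lighter.\<close>
      have "reducible (- (?c * r))"
      proof (rule sum)
        fix t' c' assume "t' \<in> Poly_Mapping.keys (- (?c * r))"
        then have "t' \<in> Poly_Mapping.keys r"
          using keys_mult[of ?c r] by (auto split: if_splits)
        then show "reducible (Poly_Mapping.single t' c')" using less g(3) by blast
      qed
      then obtain q where q: "- (?c * r) - q \<in> ideal_generated S"
        "\<forall>t\<in>Poly_Mapping.keys q. \<forall>g\<in>ideal_generated S. \<not> led_by g t"
        unfolding reducible_def by blast
      have "Poly_Mapping.single t c - q = ?c * g + (- (?c * r) - q)"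
        by (simp add: g(2) algebra_simps mult_single)
      then have "Poly_Mapping.single t c - q \<in> ideal_generated S"
        using ideal_add[OF ideal_mult[OF g(1), of ?c] q(1)] by (simp only:)
      then show ?thesis using q(2) unfolding reducible_def by blast
    next
      case False
      then show ?thesis
        unfolding reducible_def
        by (intro exI[of _ "Poly_Mapping.single t c"]) (auto intro: ideal_zero split: if_splits)
    qed
  qed
  then have "reducible p" by (rule sum)
  then show thesis using that unfolding reducible_def by blast
qed

section \<open>Minors\<close>

definition increasing :: "('p::finite \<Rightarrow> 'm::finite) \<Rightarrow> bool" where
  "increasing \<rho> \<longleftrightarrow> (\<forall>a b. pos a < pos b \<longrightarrow> pos (\<rho> a) < pos (\<rho> b))"

lemma increasing_less: "increasing \<rho> \<Longrightarrow> pos a < pos b \<Longrightarrow> pos (\<rho> a) < pos (\<rho> b)"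
  by (simp add: increasing_def)

lemma increasing_inj: "increasing \<rho> \<Longrightarrow> inj \<rho>"
  unfolding increasing_def by (intro injI) (metis less_irrefl linorder_neqE_nat pos_eq_iff)

definition minor :: "('p::finite \<Rightarrow> 'm) \<Rightarrow> ('p \<Rightarrow> 'q) \<Rightarrow> ('m \<times> 'q, 'k::comm_ring_1) mpoly" where
  "minor \<rho> \<gamma> = det (\<chi> a b. indet (\<rho> a, \<gamma> b))"

text \<open>
  The exponent vector of the product of the variables in \<open>P\<close>.
\<close>

definition squarefree_exponent :: "'v set \<Rightarrow> 'v \<Rightarrow>\<^sub>0 nat" where
  "squarefree_exponent P = (\<Sum>v\<in>P. Poly_Mapping.single v 1)"

lemma prod_indet: "(\<Prod>a\<in>A. indet (f a)) = Poly_Mapping.single (\<Sum>a\<in>A. Poly_Mapping.single (f a) 1) 1"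
  by (induction A rule: infinite_finite_induct) (auto simp: indet_def mult_single)

lemma keys_of_sign: "Poly_Mapping.keys (of_int c * p) \<subseteq> Poly_Mapping.keys (p :: ('v, 'k::comm_ring_1) mpoly)"
proof -
  have "Poly_Mapping.keys (of_int c :: ('v, 'k) mpoly) \<subseteq> {0}"
    by (auto simp: in_keys_iff lookup_of_int when_def split: if_splits)
  then show ?thesis
    using keys_mult[of "of_int c" p] by fastforce
qed

lemma lookup_sum_single:
  "Poly_Mapping.lookup (\<Sum>a\<in>UNIV. Poly_Mapping.single (f a) (1::nat)) v = card {a :: 'p::finite. f a = v}"
  by (simp add: lookup_sum lookup_single when_def sum.If_cases)

text \<open>
  All terms of the Leibniz formula have the same row and column sums, and the diagonal one
  is a chain, so \<open>quadrant_ge_chain\<close> makes it the unique heaviest.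
\<close>

lemma minor_led_by_diagonal:
  fixes \<rho> :: "'p::finite \<Rightarrow> 'm::finite" and \<gamma> :: "'p \<Rightarrow> 'q::finite"
  assumes \<rho>: "increasing \<rho>" and \<gamma>: "increasing \<gamma>"
  shows "led_by (minor \<rho> \<gamma> :: ('m \<times> 'q, 'k::comm_ring_1) mpoly) (squarefree_exponent (range (\<lambda>a. (\<rho> a, \<gamma> a))))"
proof -
  define e where "e \<sigma> = (\<Sum>a\<in>UNIV. Poly_Mapping.single (\<rho> a, \<gamma> (\<sigma> a)) (1::nat))" for \<sigma>
  have inj: "inj \<rho>" "inj \<gamma>" using \<rho> \<gamma> by (auto intro: increasing_inj)
  have sq: "squarefree_exponent (range (\<lambda>a. (\<rho> a, \<gamma> a))) = e id"
    unfolding squarefree_exponent_def e_def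
    by (subst sum.reindex) (use inj in \<open>auto simp: inj_on_def\<close>)
  have lk: "Poly_Mapping.lookup (e \<sigma>) v = card {a. (\<rho> a, \<gamma> (\<sigma> a)) = v}" for \<sigma> v
    unfolding e_def by (rule lookup_sum_single)
  have less: "exponent_weight (e \<sigma>) < exponent_weight (e id)"
    if \<sigma>: "\<sigma> permutes UNIV" "\<sigma> \<noteq> id" for \<sigma>
  proof (rule ccontr)
    assume not_less: "\<not> ?thesis"
    have row: "row_sum (Poly_Mapping.lookup (e \<sigma>)) i = card {a. \<rho> a = i}" for i \<sigma>
    proof -
      have "(\<Sum>j\<in>UNIV. \<Sum>a | a \<in> {a. \<rho> a = i} \<and> \<gamma> (\<sigma> a) = j. 1) = (\<Sum>a\<in>{a. \<rho> a = i}. 1 :: nat)"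
        by (rule sum.group) auto
      then show ?thesis unfolding row_sum_def lk by simp
    qed
    have col: "col_sum (Poly_Mapping.lookup (e \<sigma>)) j = card {a. \<gamma> a = j}"
      if \<sigma>: "\<sigma> permutes UNIV" for j \<sigma>
    proof -
      have "(\<Sum>i\<in>UNIV. \<Sum>a | a \<in> {a. \<gamma> (\<sigma> a) = j} \<and> \<rho> a = i. 1) = (\<Sum>a\<in>{a. \<gamma> (\<sigma> a) = j}. 1 :: nat)"
        by (rule sum.group) auto
      moreover have "card {a. \<gamma> (\<sigma> a) = j} = card {a. \<gamma> a = j}"
      proof (rule bij_betw_same_card)
        show "bij_betw \<sigma> {a. \<gamma> (\<sigma> a) = j} {a. \<gamma> a = j}"
          using \<sigma> by (intro bij_betw_byWitness[where f' = "inv \<sigma>"]) (auto simp: permutes_inverses)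
      qed
      ultimately show ?thesis unfolding col_sum_def lk by (simp add: conj_commute)
    qed
    have eq: "Poly_Mapping.lookup (e id) = Poly_Mapping.lookup (e \<sigma>)"
    proof (rule weight_minimal_unique)
      show "exponent_weight (e id) \<le> exponent_weight (e \<sigma>)" using not_less by simp
      show "quadrant (Poly_Mapping.lookup (e \<sigma>)) s t \<le> quadrant (Poly_Mapping.lookup (e id)) s t" for s t
      proof (rule quadrant_ge_chain)
        fix v w assume "Poly_Mapping.lookup (e id) v \<noteq> 0" "Poly_Mapping.lookup (e id) w \<noteq> 0"
        then obtain a b where ab: "v = (\<rho> a, \<gamma> a)" "w = (\<rho> b, \<gamma> b)"
          unfolding lk by (auto simp: card_eq_0_iff)
        show "v = w \<or> southeast v w \<or> southeast w v"
          using linorder_less_linear[of "pos a" "pos b"]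
          by (auto simp: ab southeast_def intro: increasing_less[OF \<rho>] increasing_less[OF \<gamma>])
      qed (simp_all add: row col \<sigma> permutes_id)
    qed
    have "\<sigma> a = a" for a
    proof -
      have "Poly_Mapping.lookup (e \<sigma>) (\<rho> a, \<gamma> (\<sigma> a)) \<noteq> 0"
        unfolding lk by (auto simp: card_eq_0_iff)
      then have "Poly_Mapping.lookup (e id) (\<rho> a, \<gamma> (\<sigma> a)) \<noteq> 0" using eq by simp
      then show ?thesis
        unfolding lk using inj by (auto simp: card_eq_0_iff dest: injD)
    qed
    then show False using \<sigma>(2) by auto
  qed
  show ?thesis
    unfolding minor_def det_def sq
  proof (rule led_by_sum[where a = id])
    show "finite {\<sigma>. \<sigma> permutes (UNIV :: 'p set)}" by (simp add: finite_permutations)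
    show "id \<in> {\<sigma>. \<sigma> permutes (UNIV :: 'p set)}" by (simp add: permutes_id)
    show "of_int (sign id) * (\<Prod>i\<in>UNIV. (\<chi> a b. indet (\<rho> a, \<gamma> b)) $ i $ id i) = Poly_Mapping.single (e id) 1"
      by (simp add: sign_id prod_indet e_def)
    fix \<sigma> t' assume \<sigma>: "\<sigma> \<in> {\<sigma>. \<sigma> permutes (UNIV :: 'p set)}" "\<sigma> \<noteq> id"
      and "t' \<in> Poly_Mapping.keys (of_int (sign \<sigma>) * (\<Prod>i\<in>UNIV. (\<chi> a b. indet (\<rho> a, \<gamma> b)) $ i $ \<sigma> i) :: ('m \<times> 'q, 'k) mpoly)"
    then have "t' \<in> Poly_Mapping.keys (\<Prod>i\<in>UNIV. (\<chi> a b. indet (\<rho> a, \<gamma> b)) $ i $ \<sigma> i :: ('m \<times> 'q, 'k) mpoly)"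
      using keys_of_sign by blast
    then have "t' = e \<sigma>" by (simp add: prod_indet e_def)
    then show "exponent_weight t' < exponent_weight (e id)" using less \<sigma> by simp
  qed
qed

lemma squarefree_divides:
  fixes t :: "'v::finite \<Rightarrow>\<^sub>0 nat"
  assumes "P \<subseteq> Poly_Mapping.keys t"
  obtains u where "t = u + squarefree_exponent P"
proof
  show "t = (t - squarefree_exponent P) + squarefree_exponent P"
  proof (rule poly_mapping_eqI)
    fix v
    have "Poly_Mapping.lookup (squarefree_exponent P) v = of_bool (v \<in> P)"
      by (simp add: squarefree_exponent_def lookup_sum lookup_single when_def)
    then show "Poly_Mapping.lookup t v =
        Poly_Mapping.lookup ((t - squarefree_exponent P) + squarefree_exponent P) v"
      using assms by (auto simp: lookup_add lookup_minus in_keys_iff)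
  qed
qed

lemma led_by_multiple:
  assumes g: "g \<in> ideal_generated S" and led: "led_by g (squarefree_exponent P)"
    and P: "P \<subseteq> Poly_Mapping.keys t"
  shows "\<exists>g'\<in>ideal_generated S. led_by g' t"
proof -
  obtain u where u: "t = u + squarefree_exponent P"
    using squarefree_divides[OF P] .
  show ?thesis
  proof
    show "led_by (Poly_Mapping.single u 1 * g) t"
      unfolding u by (intro led_by_mult led_by_single led)
    show "Poly_Mapping.single u 1 * g \<in> ideal_generated S"
      using g by (rule ideal_mult)
  qed
qed

section \<open>Chains and layers\<close>

definition chain :: "('v \<Rightarrow> 'v \<Rightarrow> bool) \<Rightarrow> 'v set \<Rightarrow> (nat \<Rightarrow> 'v) \<Rightarrow> nat \<Rightarrow> bool" where
  "chain R S p n \<longleftrightarrow> (\<forall>a<n. p a \<in> S) \<and> (\<forall>a. Suc a < n \<longrightarrow> R (p a) (p (Suc a)))"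

lemma chain_prefix: "chain R S p n \<Longrightarrow> k \<le> n \<Longrightarrow> chain R S p k"
  by (auto simp: chain_def)

lemma chain_less:
  assumes "chain R S p n" and trans: "\<And>u v w. R u v \<Longrightarrow> R v w \<Longrightarrow> R u w"
  shows "a < b \<Longrightarrow> b < n \<Longrightarrow> R (p a) (p b)"
proof (induction b)
  case (Suc b)
  then have "R (p b) (p (Suc b))" using assms(1) by (auto simp: chain_def)
  then show ?case using Suc trans by (cases "a = b") auto
qed simp

text \<open>
  Mirsky's theorem: layers are formed by the length of the longest chain that ends at an element.
  The last clause records that an element of the top layer ends a chain of \<open>n\<close> elements.
\<close>

lemma layers_of_no_chain:
  assumes no_chain: "\<And>p. \<not> chain R S p (Suc n)"
  shows "\<exists>layer. (\<forall>v\<in>S. layer v < n) \<and> (\<forall>v\<in>S. \<forall>w\<in>S. R v w \<longrightarrow> layer v \<noteq> layer w) \<and>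
    (\<forall>v\<in>S. \<exists>p. chain R S p (Suc (layer v)) \<and> p (layer v) = v)"
proof -
  \<comment> \<open>A chain with \<open>Suc k\<close> elements is meant, so that layers are numbered from \<open>0\<close>.\<close>
  define ends where "ends v k \<longleftrightarrow> (\<exists>p. chain R S p (Suc k) \<and> p k = v)" for v k
  define layer where "layer v = (GREATEST k. ends v k)" for v
  have bound: "k < n" if "ends v k" for v k
    using that no_chain chain_prefix[of R S _ "Suc k" "Suc n"] unfolding ends_def
    by (meson Suc_le_mono not_le_imp_less)
  have ends: "ends v (layer v)" if "v \<in> S" for v
    unfolding layer_def
  proof (rule GreatestI_nat)
    show "ends v 0" using that unfolding ends_def chain_def by (intro exI[of _ "\<lambda>_. v"]) auto
    show "\<And>k. ends v k \<Longrightarrow> k \<le> n" using bound by (simp add: less_imp_le)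
  qed
  have less: "layer v < layer w" if "v \<in> S" "w \<in> S" "R v w" for v w
  proof -
    obtain p where p: "chain R S p (Suc (layer v))" "p (layer v) = v"
      using ends[OF \<open>v \<in> S\<close>] unfolding ends_def by blast
    have "chain R S (p(Suc (layer v) := w)) (Suc (Suc (layer v)))"
      using p that unfolding chain_def by (auto simp: less_Suc_eq)
    then have "ends w (Suc (layer v))"
      unfolding ends_def by (intro exI[of _ "p(Suc (layer v) := w)"]) auto
    then have "Suc (layer v) \<le> layer w"
      unfolding layer_def by (rule Greatest_le_nat[where b = n]) (use bound in \<open>simp add: less_imp_le\<close>)
    then show ?thesis by simp
  qed
  have "\<forall>v\<in>S. layer v < n" using ends bound by blast
  moreover have "\<forall>v\<in>S. \<forall>w\<in>S. R v w \<longrightarrow> layer v \<noteq> layer w" using less by fastforce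
  moreover have "\<forall>v\<in>S. \<exists>p. chain R S p (Suc (layer v)) \<and> p (layer v) = v"
    using ends unfolding ends_def by blast
  ultimately show ?thesis by blast
qed

lemma chain_imp_increasing:
  assumes "chain southeast S p (CARD('p::finite))"
  shows "increasing (\<lambda>a :: 'p. fst (p (pos a)))" "increasing (\<lambda>a :: 'p. snd (p (pos a)))"
    "range (\<lambda>a :: 'p. (fst (p (pos a)), snd (p (pos a)))) \<subseteq> S"
proof -
  have "southeast (p (pos a)) (p (pos b))" if "pos a < pos b" for a b :: 'p
    using chain_less[OF assms southeast_trans that pos_less] .
  then show "increasing (\<lambda>a :: 'p. fst (p (pos a)))" "increasing (\<lambda>a :: 'p. snd (p (pos a)))"
    by (auto simp: increasing_def southeast_def)
  show "range (\<lambda>a :: 'p. (fst (p (pos a)), snd (p (pos a)))) \<subseteq> S"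
    using assms by (auto simp: chain_def)
qed

text \<open>
  Row and column numbers grow by at least one in each step of a chain. With the two bounds in
  \<open>chain_bounds\<close> this fixes the rows of a chain that is squeezed into the first rows, and the columns
  of one that is squeezed into the last columns.
\<close>

lemma chain_gap:
  assumes "chain southeast S p n" and "b < n" and "a \<le> b"
  shows "pos (fst (p a)) + (b - a) \<le> pos (fst (p b))" and "pos (snd (p a)) + (b - a) \<le> pos (snd (p b))"
proof -
  have "pos (fst (p a)) + (b - a) \<le> pos (fst (p b)) \<and> pos (snd (p a)) + (b - a) \<le> pos (snd (p b))"
    using assms(3,2)
  proof (induction b rule: dec_induct)
    case (step k)
    then have "southeast (p k) (p (Suc k))" using assms(1) by (simp add: chain_def)
    then show ?case using step by (auto simp: southeast_def)
  qed simp
  then show "pos (fst (p a)) + (b - a) \<le> pos (fst (p b))" "pos (snd (p a)) + (b - a) \<le> pos (snd (p b))"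
    by blast+
qed

lemma chain_bounds:
  fixes p :: "nat \<Rightarrow> 'm::finite \<times> 'q::finite"
  assumes "chain southeast S p n" and "a < n"
  shows "a \<le> pos (fst (p a))" and "pos (snd (p a)) + n \<le> CARD('q) + a"
proof -
  show "a \<le> pos (fst (p a))"
    using chain_gap(1)[OF assms, of 0] by simp
  show "pos (snd (p a)) + n \<le> CARD('q) + a"
    using chain_gap(2)[OF assms(1), of "n - 1" a] pos_less[of "snd (p (n - 1))"] assms(2) by linarith
qed

section \<open>Minors as functions\<close>

lemma substitute_uminus: "substitute F (- p) x = - substitute F p x"
  by (simp add: substitute_def sum_negf)

lemma substitute_diff: "substitute F (p - q) x = substitute F p x - substitute F q x"
  using substitute_add[of F p "- q"] by (simp add: substitute_uminus)

lemma substitute_of_int: "substitute F (of_int c) x = of_int c"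
  using fun_cong[OF substitute_const[of F "of_int c"], of x] by (simp add: single_of_int)

lemma substitute_one: "substitute F 1 x = 1"
  using substitute_of_int[of F 1 x] by simp

lemma substitute_prod: "substitute F (\<Prod>a\<in>A. f a) x = (\<Prod>a\<in>A. substitute F (f a) x)"
  by (induction A rule: infinite_finite_induct) (auto simp: substitute_one substitute_mult)

lemma pullback_minor: "pullback (minor \<rho> \<gamma>) x = det (\<chi> a b. \<phi> (\<rho> a) (\<gamma> b) x)"
  unfolding minor_def det_def
  by (simp add: substitute_sum finite_permutations substitute_mult substitute_of_int substitute_prod
      substitute_indet)

lemma phi_sum: "\<phi> i j x = (\<Sum>k\<in>UNIV. fst x i $ k * dual_apply (snd x j) (axis k 1))"
proof -
  interpret Vector_Spaces.linear "(*s)" "(*)" "dual_apply (snd x j)"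
    using dual_apply[of "snd x j"] by simp
  have "fst x i = (\<Sum>k\<in>UNIV. fst x i $ k *s axis k 1)"
    by (simp add: basis_expansion)
  then have "dual_apply (snd x j) (fst x i) = dual_apply (snd x j) (\<Sum>k\<in>UNIV. fst x i $ k *s axis k 1)"
    by simp
  then show ?thesis by (simp add: \<phi>_def sum scale)
qed

lemma pullback_minor_factor:
  fixes x :: "('k::field, 'n::finite, 'm, 'q) space" and \<rho> :: "'n \<Rightarrow> 'm"
  shows "pullback (minor \<rho> \<gamma>) x =
    det (\<chi> a k. fst x (\<rho> a) $ k) * det (\<chi> k b. dual_apply (snd x (\<gamma> b)) (axis k 1))"
proof -
  have "(\<chi> a b. \<phi> (\<rho> a) (\<gamma> b) x) = (\<chi> a k. fst x (\<rho> a) $ k) ** (\<chi> k b. dual_apply (snd x (\<gamma> b)) (axis k 1))"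
    by (simp add: matrix_matrix_mult_def phi_sum vec_eq_iff)
  then show ?thesis by (simp add: pullback_minor det_mul)
qed

text \<open>
  The \<open>(n + 1)\<close>-minors vanish on products through \<open>K\<^sup>n\<close>: padding both factors by a zero column and a zero
  row makes them square, with determinant zero.
\<close>

lemma pullback_minor_option:
  fixes x :: "('k::field, 'n::finite, 'm, 'q) space" and \<rho> :: "'n option \<Rightarrow> 'm"
  shows "pullback (minor \<rho> \<gamma>) x = 0"
proof -
  define A :: "'k ^ 'n option ^ 'n option"
    where "A = (\<chi> a l. case l of None \<Rightarrow> 0 | Some k \<Rightarrow> fst x (\<rho> a) $ k)"
  define B :: "'k ^ 'n option ^ 'n option"
    where "B = (\<chi> l b. case l of None \<Rightarrow> 0 | Some k \<Rightarrow> dual_apply (snd x (\<gamma> b)) (axis k 1))"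
  have "(\<chi> a b. \<phi> (\<rho> a) (\<gamma> b) x) = A ** B"
    by (simp add: matrix_matrix_mult_def phi_sum vec_eq_iff A_def B_def UNIV_option_conv sum.reindex)
  moreover have "det B = 0"
    by (rule det_zero_row(2)[of None]) (simp add: B_def row_def vec_eq_iff)
  ultimately show ?thesis by (simp add: pullback_minor det_mul)
qed

lemma minors_eq: "minors TYPE('p::finite) (\<chi> i j. indet (i, j)) =
   {minor \<rho> \<gamma> | (\<rho> :: 'p \<Rightarrow> 'm::finite) (\<gamma> :: 'p \<Rightarrow> 'q::finite). inj \<rho> \<and> inj \<gamma>}"
  by (auto simp: minors_def minor_def)

section \<open>The second fundamental theorem\<close>

abbreviation determinantal_ideal :: "'p::finite itself \<Rightarrow> ('m::finite \<times> 'q::finite, 'k::field) mpoly set" where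
  "determinantal_ideal P \<equiv> ideal_generated (minors P (\<chi> i j. indet (i, j)))"

lemma pullback_ideal:
  assumes "p \<in> ideal_generated S" and "\<And>g. g \<in> S \<Longrightarrow> pullback g x = 0"
  shows "pullback p x = 0"
  using assms(1)
proof (induction rule: ideal_induct)
  case base
  then show ?case by (simp add: substitute_def)
next
  case (step c g q)
  then show ?case using assms(2) by (simp add: substitute_add substitute_mult)
qed

lemma pullback_determinantal_ideal:
  fixes x :: "('k::field, 'n::finite, 'm::finite, 'q::finite) space"
  assumes "p \<in> determinantal_ideal TYPE('n option)"
  shows "pullback p x = 0"
  using assms by (rule pullback_ideal) (auto simp: minors_eq pullback_minor_option)

lemma no_chain_of_irreducible:
  fixes t :: "'m::finite \<times> 'q::finite \<Rightarrow>\<^sub>0 nat"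
  assumes "\<And>g :: ('m \<times> 'q, 'k::field) mpoly. g \<in> ideal_generated S \<Longrightarrow> \<not> led_by g t"
    and "minors TYPE('n::finite option) (\<chi> i j. indet (i, j)) \<subseteq> S"
  shows "\<not> chain southeast (Poly_Mapping.keys t) p (Suc (CARD('n)))"
proof
  assume "chain southeast (Poly_Mapping.keys t) p (Suc (CARD('n)))"
  then have *: "chain southeast (Poly_Mapping.keys t) p (CARD('n option))"
    by simp
  let ?\<rho> = "\<lambda>a :: 'n option. fst (p (pos a))" and ?\<gamma> = "\<lambda>a :: 'n option. snd (p (pos a))"
  note incr = chain_imp_increasing[OF *]
  have "(minor ?\<rho> ?\<gamma> :: ('m \<times> 'q, 'k) mpoly) \<in> S"
    using assms(2) increasing_inj[OF incr(1)] increasing_inj[OF incr(2)] unfolding minors_eq by blast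
  then have "(minor ?\<rho> ?\<gamma> :: ('m \<times> 'q, 'k) mpoly) \<in> ideal_generated S"
    by (rule ideal_base)
  then have "\<exists>g\<in>ideal_generated S. led_by (g :: ('m \<times> 'q, 'k) mpoly) t"
    using minor_led_by_diagonal[OF incr(1,2)] incr(3) by (rule led_by_multiple)
  then show False using assms(1) by blast
qed

lemma exists_max_weight:
  fixes p :: "('m::finite \<times> 'q::finite, 'k::zero) mpoly"
  assumes "p \<noteq> 0"
  obtains t where "t \<in> Poly_Mapping.keys p"
    "\<And>t'. t' \<in> Poly_Mapping.keys p \<Longrightarrow> exponent_weight t' \<le> exponent_weight t"
proof -
  have "Poly_Mapping.keys p \<noteq> {}" using assms by simp
  then have "\<exists>t\<in>Poly_Mapping.keys p. exponent_weight t = Max (exponent_weight ` Poly_Mapping.keys p)"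
    using Max_in[of "exponent_weight ` Poly_Mapping.keys p"] by fastforce
  then show thesis using that by (metis Max_ge finite_imageI finite_keys imageI)
qed

text \<open>
  The remainder of \<open>p\<close> modulo the minors has only monomials that can be layered, while it still
  vanishes on all products \<open>A B\<close>; so it has no monomial of largest weight.
\<close>

theorem second_fundamental_theorem:
  fixes p :: "('m::finite \<times> 'q::finite, 'k::field) mpoly"
  assumes inf: "infinite (UNIV :: 'k set)"
  shows "p \<in> determinantal_ideal TYPE('n::finite option) \<longleftrightarrow>
    (\<forall>x :: ('k, 'n, 'm, 'q) space. pullback p x = 0)"
proof
  assume "p \<in> determinantal_ideal TYPE('n option)"
  then show "\<forall>x :: ('k, 'n, 'm, 'q) space. pullback p x = 0"
    using pullback_determinantal_ideal by blast
next
  assume p: "\<forall>x :: ('k, 'n, 'm, 'q) space. pullback p x = 0"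
  let ?I = "determinantal_ideal TYPE('n option) :: ('m \<times> 'q, 'k) mpoly set"
  obtain r where r: "p - r \<in> ?I" and irred: "\<And>t g. t \<in> Poly_Mapping.keys r \<Longrightarrow> g \<in> ?I \<Longrightarrow> \<not> led_by g t"
    using reduction[of p "minors TYPE('n option) (\<chi> i j. indet (i, j))"] by blast
  have vanish: "pullback r x = 0" for x :: "('k, 'n, 'm, 'q) space"
    using pullback_determinantal_ideal[OF r, of x] p by (simp add: substitute_diff)
  have "r = 0"
  proof (rule ccontr)
    assume "r \<noteq> 0"
    then obtain t where t: "t \<in> Poly_Mapping.keys r"
      "\<And>t'. t' \<in> Poly_Mapping.keys r \<Longrightarrow> exponent_weight t' \<le> exponent_weight t"
      using exists_max_weight by blast
    have no_chain: "\<not> chain southeast (Poly_Mapping.keys t) p (Suc (CARD('n)))" for p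
      using no_chain_of_irreducible[OF irred[OF t(1)] order_refl] .
    obtain layer where layer: "\<forall>v\<in>Poly_Mapping.keys t. layer v < CARD('n)"
      "\<forall>v\<in>Poly_Mapping.keys t. \<forall>w\<in>Poly_Mapping.keys t. southeast v w \<longrightarrow> layer v \<noteq> layer w"
      using layers_of_no_chain[OF no_chain] by blast
    have "t \<notin> Poly_Mapping.keys r"
      by (rule coefficient_eq_0_of_layering[OF inf t(2), where layer = "\<lambda>v. elem_at (layer v) :: 'n"])
        (use layer vanish in \<open>auto simp: elem_at_eq_iff\<close>)
    then show False using t by blast
  qed
  then show "p \<in> ?I" using r by simp
qed

section \<open>Polynomials vanishing where a maximal minor vanishes\<close>

definition initial_elem :: "'n::finite \<Rightarrow> 'm::finite" where
  "initial_elem a = elem_at (pos a)"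

definition final_elem :: "'n::finite \<Rightarrow> 'q::finite" where
  "final_elem a = elem_at (CARD('q) - CARD('n) + pos a)"

lemma pos_initial_elem:
  "CARD('n) \<le> CARD('m) \<Longrightarrow> pos (initial_elem (a :: 'n::finite) :: 'm::finite) = pos a"
  unfolding initial_elem_def by (rule pos_elem_at) (use pos_less[of a] in linarith)

lemma pos_final_elem:
  "CARD('n) \<le> CARD('q) \<Longrightarrow>
    pos (final_elem (a :: 'n::finite) :: 'q::finite) = CARD('q) - CARD('n) + pos a"
  unfolding final_elem_def by (rule pos_elem_at) (use pos_less[of a] in linarith)

lemma initial_elem_eq_iff:
  fixes a b :: "'n::finite"
  assumes "CARD('n) \<le> CARD('m::finite)"
  shows "(initial_elem a :: 'm) = initial_elem b \<longleftrightarrow> a = b"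
  using pos_eq_iff[of "initial_elem a :: 'm" "initial_elem b"] unfolding pos_initial_elem[OF assms] by simp

lemma final_elem_eq_iff:
  fixes a b :: "'n::finite"
  assumes "CARD('n) \<le> CARD('q::finite)"
  shows "(final_elem a :: 'q) = final_elem b \<longleftrightarrow> a = b"
  using pos_eq_iff[of "final_elem a :: 'q" "final_elem b"] unfolding pos_final_elem[OF assms] by simp

lemma chain_reverse:
  assumes "chain (\<lambda>v w. R w v) S p n"
  shows "chain R S (\<lambda>a. p (n - Suc a)) n"
  unfolding chain_def
proof (intro conjI allI impI)
  fix a assume "a < n"
  then show "p (n - Suc a) \<in> S" using assms by (simp add: chain_def)
next
  fix a assume a: "Suc a < n"
  then have "Suc (n - Suc (Suc a)) = n - Suc a" by simp
  then show "R (p (n - Suc a)) (p (n - Suc (Suc a)))"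
    using assms a unfolding chain_def by (metis diff_less zero_less_Suc less_trans Suc_lessD)
qed

text \<open>
  Two chains of \<open>n\<close> elements that cross can be switched at the crossing point. The join is longer than
  \<open>n\<close> if the crossing comes later in the first chain than in the second.
\<close>

lemma chain_join:
  assumes p: "chain R S p n" and p': "chain R S p' n" and eq: "p a = p' b" and "a < n" "b < n"
  shows "chain R S (\<lambda>k. if k \<le> a then p k else p' (k - a + b)) (a + (n - b))"
  unfolding chain_def
proof (intro conjI allI impI)
  fix k assume "k < a + (n - b)"
  then show "(if k \<le> a then p k else p' (k - a + b)) \<in> S"
    using p p' \<open>a < n\<close> by (auto simp: chain_def)
next
  fix k assume k: "Suc k < a + (n - b)"
  consider "Suc k \<le> a" | "k = a" | "a < k" by linarith
  then show "R (if k \<le> a then p k else p' (k - a + b))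
      (if Suc k \<le> a then p (Suc k) else p' (Suc k - a + b))"
  proof cases
    case 1
    then show ?thesis using p \<open>a < n\<close> by (auto simp: chain_def)
  next
    case 2
    then show ?thesis using p' k eq by (auto simp: chain_def)
  next
    case 3
    then have "Suc k - a + b = Suc (k - a + b)" by simp
    then show ?thesis using p' k 3 by (auto simp: chain_def)
  qed
qed

lemma squarefree_exponent_Un:
  "finite P \<Longrightarrow> finite Q \<Longrightarrow> P \<inter> Q = {} \<Longrightarrow>
    squarefree_exponent (P \<union> Q) = squarefree_exponent P + squarefree_exponent Q"
  by (simp add: squarefree_exponent_def sum.union_disjoint)

text \<open>
  An \<open>n\<close>-minor of \<open>A B\<close> is a minor of \<open>A\<close> times a minor of \<open>B\<close>, so in a product of two of
  them the column sets can be exchanged. The second fundamental theorem turns this identity of functions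
  into a congruence.
\<close>

lemma exchange_minors:
  fixes \<rho> \<rho>' :: "'n::finite \<Rightarrow> 'm::finite" and \<gamma> \<gamma>' :: "'n \<Rightarrow> 'q::finite"
  assumes "infinite (UNIV :: 'k set)"
  shows "minor \<rho> \<gamma> * minor \<rho>' \<gamma>' - minor \<rho>' \<gamma> * minor \<rho> \<gamma>'
    \<in> (determinantal_ideal TYPE('n option) :: ('m \<times> 'q, 'k::field) mpoly set)"
  unfolding second_fundamental_theorem[OF assms]
  by (simp add: substitute_diff substitute_mult pullback_minor_factor)

text \<open>
  If the two chains are disjoint, exchanging columns shows that the product of the minors whose
  diagonals they are is congruent to a multiple of \<open>\<delta>\<close>, and this product is led by a divisor of \<open>t\<close>. If they
  meet, then the row numbers, together with the chain obtained by switching, force them to meet at the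
  same index; the part of the second chain before that index and the part of the first chain after it form the
  diagonal of \<open>\<delta>\<close> itself. It is for this case that \<open>\<delta>\<close> takes its rows and columns from opposite
  ends.
\<close>

lemma two_chains_reducible:
  fixes t :: "'m::finite \<times> 'q::finite \<Rightarrow>\<^sub>0 nat"
  defines "\<delta> \<equiv> minor (initial_elem :: 'n::finite \<Rightarrow> 'm) (final_elem :: 'n \<Rightarrow> 'q) :: ('m \<times> 'q, 'k::field) mpoly"
    and "n \<equiv> CARD('n)"
  assumes inf: "infinite (UNIV :: 'k set)" and card: "n \<le> CARD('m)" "n \<le> CARD('q)"
    and no_chain: "\<And>p. \<not> chain southeast (Poly_Mapping.keys t) p (Suc n)"
    and p: "chain southeast (Poly_Mapping.keys t) p n" "\<And>a. a < n \<Longrightarrow> pos (fst (p a)) = a"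
    and p': "chain southeast (Poly_Mapping.keys t) p' n"
      "\<And>a. a < n \<Longrightarrow> pos (snd (p' a)) = CARD('q) - n + a"
  shows "\<exists>g\<in>ideal_generated (insert \<delta> (minors TYPE('n option) (\<chi> i j. indet (i, j)))). led_by g t"
    (is "\<exists>g\<in>ideal_generated ?S. _")
proof -
  let ?\<iota> = "initial_elem :: 'n \<Rightarrow> 'm" and ?\<kappa> = "final_elem :: 'n \<Rightarrow> 'q"
  have pos_\<iota>: "pos (?\<iota> a) = pos a" and pos_\<kappa>: "pos (?\<kappa> a) = CARD('q) - n + pos a" for a
    using card by (simp_all add: pos_initial_elem pos_final_elem n_def)
  have incr: "increasing ?\<iota>" "increasing ?\<kappa>"
    by (simp_all add: increasing_def pos_\<iota> pos_\<kappa>)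
  have \<delta>: "\<delta> \<in> ideal_generated ?S"
    by (intro ideal_base) simp
  show ?thesis
  proof (cases "p ` {..<n} \<inter> p' ` {..<n} = {}")
    case True
    let ?\<gamma> = "\<lambda>a :: 'n. snd (p (pos a))" and ?\<rho> = "\<lambda>a :: 'n. fst (p' (pos a))"
    note c = chain_imp_increasing[where 'p = 'n, OF p(1)[unfolded n_def]]
    note c' = chain_imp_increasing[where 'p = 'n, OF p'(1)[unfolded n_def]]
    have "?\<iota> a = fst (p (pos a))" "?\<kappa> a = snd (p' (pos a))" for a
      using p(2)[of "pos a"] p'(2)[of "pos a"] pos_less[of a]
      by (simp_all add: n_def pos_\<iota> pos_\<kappa> flip: pos_eq_iff)
    then have \<iota>\<gamma>: "(?\<iota> a, ?\<gamma> a) = p (pos a)" and \<rho>\<kappa>: "(?\<rho> a, ?\<kappa> a) = p' (pos a)" for a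
      by simp_all
    let ?P = "range (\<lambda>a. (?\<iota> a, ?\<gamma> a))" and ?P' = "range (\<lambda>a. (?\<rho> a, ?\<kappa> a))"
    have "?P \<inter> ?P' = {}"
      using True unfolding \<iota>\<gamma> \<rho>\<kappa> by (fastforce simp: n_def)
    then have sq: "squarefree_exponent (?P \<union> ?P') = squarefree_exponent ?P + squarefree_exponent ?P'"
      by (intro squarefree_exponent_Un) auto
    have led: "led_by (minor ?\<iota> ?\<gamma> * minor ?\<rho> ?\<kappa> :: ('m \<times> 'q, 'k) mpoly) (squarefree_exponent (?P \<union> ?P'))"
      unfolding sq by (intro led_by_mult minor_led_by_diagonal incr c c')
    have "minor ?\<iota> ?\<gamma> * minor ?\<rho> ?\<kappa> - minor ?\<rho> ?\<gamma> * \<delta> \<in> ideal_generated (minors TYPE('n option) (\<chi> i j. indet (i, j)))"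
      unfolding \<delta>_def by (rule exchange_minors[OF inf])
    then have mem: "minor ?\<iota> ?\<gamma> * minor ?\<rho> ?\<kappa> \<in> ideal_generated ?S"
      unfolding ideal_insert by blast
    have "?P \<union> ?P' \<subseteq> Poly_Mapping.keys t"
      using p(1) p'(1) unfolding \<iota>\<gamma> \<rho>\<kappa> by (auto simp: chain_def n_def)
    with mem led show ?thesis by (rule led_by_multiple)
  next
    case False
    then obtain a b where "a \<in> {..<n}" "b \<in> {..<n}" "p a = p' b" by blast
    then have ab: "a < n" "b < n" "p a = p' b" by simp_all
    have "a \<le> b"
    proof (rule ccontr)
      assume "\<not> a \<le> b"
      then have "Suc n \<le> a + (n - b)" using ab by linarith
      from chain_prefix[OF chain_join[OF p(1) p'(1) ab(3,1,2)] this] show False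
        using no_chain by blast
    qed
    moreover have "b \<le> a"
      using chain_bounds(1)[OF p'(1) ab(2)] p(2)[OF ab(1)] ab(3) by simp
    ultimately have "b = a" by simp
    note eq = ab(3)[unfolded this]
    have diag: "(?\<iota> c, ?\<kappa> c) = (if pos c \<le> a then p' (pos c) else p (pos c))" for c
    proof -
      have c: "pos c < n" by (simp add: n_def)
      show ?thesis
      proof (cases "pos c \<le> a")
        case True
        have "pos (fst (p' (pos c))) = pos c"
          using chain_gap(1)[OF p'(1) ab(1) True] chain_bounds(1)[OF p'(1) c] p(2)[OF ab(1)] eq True by simp
        then show ?thesis
          using p'(2)[OF c] True by (simp add: prod_eq_iff pos_\<iota> pos_\<kappa> flip: pos_eq_iff)
      next
        case False
        then have "a \<le> pos c" by simp
        have "pos (snd (p (pos c))) = CARD('q) - n + pos c"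
          using chain_gap(2)[OF p(1) c \<open>a \<le> pos c\<close>] chain_bounds(2)[OF p(1) c] p'(2)[OF ab(1)] eq
            card(2) \<open>a \<le> pos c\<close> by simp
        then show ?thesis
          using p(2)[OF c] False by (simp add: prod_eq_iff pos_\<iota> pos_\<kappa> flip: pos_eq_iff)
      qed
    qed
    have "range (\<lambda>c. (?\<iota> c, ?\<kappa> c)) \<subseteq> Poly_Mapping.keys t"
      using p(1) p'(1) unfolding diag by (auto simp: chain_def n_def)
    then show ?thesis
      using led_by_multiple[OF \<delta>] minor_led_by_diagonal[OF incr] unfolding \<delta>_def by blast
  qed
qed

text \<open>
  Layers by chains that end at an element suit the first rows: an element of the top layer within the
  first \<open>n\<close> rows ends a chain through exactly these rows. For the last columns the layers are formed by
  chains that start at an element.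
\<close>

lemma not_key_of_irreducible:
  fixes r :: "('m::finite \<times> 'q::finite, 'k::field) mpoly"
  defines "\<delta> \<equiv> minor (initial_elem :: 'n::finite \<Rightarrow> 'm) (final_elem :: 'n \<Rightarrow> 'q) :: ('m \<times> 'q, 'k::field) mpoly"
  assumes inf: "infinite (UNIV :: 'k set)" and card: "CARD('n) \<le> CARD('m)" "CARD('n) \<le> CARD('q)"
    and vanish: "\<And>x :: ('k, 'n, 'm, 'q) space. pullback \<delta> x = 0 \<Longrightarrow> pullback r x = 0"
    and irred: "\<And>g. g \<in> ideal_generated (insert \<delta> (minors TYPE('n option) (\<chi> i j. indet (i, j)))) \<Longrightarrow> \<not> led_by g t"
    and max: "\<And>t'. t' \<in> Poly_Mapping.keys r \<Longrightarrow> exponent_weight t' \<le> exponent_weight t"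
  shows "t \<notin> Poly_Mapping.keys r"
proof -
  let ?K = "Poly_Mapping.keys t"
  define n where "n = CARD('n)"
  have n: "n > 0" by (simp add: n_def)
  define top where "top = (elem_at (n - 1) :: 'n)"
  have no_chain: "\<not> chain southeast ?K p (Suc n)" for p
    unfolding n_def by (rule no_chain_of_irreducible[OF irred]) auto
  have top: "elem_at k = top \<longleftrightarrow> k = n - 1" if "k < n" for k
    unfolding top_def using that n by (intro elem_at_eq_iff) (simp_all add: n_def)
  consider (rows) "\<nexists>p. chain southeast ?K p n \<and> (\<forall>a<n. pos (fst (p a)) = a)"
    | (cols) "\<nexists>p. chain southeast ?K p n \<and> (\<forall>a<n. pos (snd (p a)) = CARD('q) - n + a)"
    using two_chains_reducible[OF inf card no_chain[unfolded n_def]] irred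
    unfolding \<delta>_def n_def by blast
  then show ?thesis
  proof cases
    case rows
    obtain layer where layer: "\<forall>v\<in>?K. layer v < n"
      "\<forall>v\<in>?K. \<forall>w\<in>?K. southeast v w \<longrightarrow> layer v \<noteq> layer w"
      "\<forall>v\<in>?K. \<exists>p. chain southeast ?K p (Suc (layer v)) \<and> p (layer v) = v"
      using layers_of_no_chain[OF no_chain] by blast
    have not_low: "\<not> pos (fst v) < n" if v: "v \<in> ?K" "layer v = n - 1" for v
    proof
      assume low: "pos (fst v) < n"
      obtain p where p: "chain southeast ?K p n" "p (n - 1) = v"
        using layer(3) v n by fastforce
      have "pos (fst (p a)) = a" if "a < n" for a
      proof -
        have "n - 1 < n" "a \<le> n - 1" using that by simp_all
        from chain_gap(1)[OF p(1) this] show ?thesis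
          using chain_bounds(1)[OF p(1) that] low that unfolding p(2) by linarith
      qed
      then show False using rows p(1) by blast
    qed
    show ?thesis
    proof (rule coefficient_eq_0_of_layering[OF inf max, where layer = "\<lambda>v. elem_at (layer v) :: 'n"])
      show "(elem_at (layer v) :: 'n) \<noteq> elem_at (layer w)" if "v \<in> ?K" "w \<in> ?K" "southeast v w" for v w
        using layer that by (auto simp: elem_at_eq_iff n_def)
      fix x :: "('k, 'n, 'm, 'q) space"
      assume x: "\<And>i k. fst x i $ k \<noteq> 0 \<Longrightarrow> \<exists>j. (i, j) \<in> ?K \<and> elem_at (layer (i, j)) = k"
      have "fst x (initial_elem (a :: 'n)) $ top = 0" for a
      proof (rule ccontr)
        assume "fst x (initial_elem a) $ top \<noteq> 0"
        then obtain j where j: "(initial_elem a, j) \<in> ?K" "elem_at (layer (initial_elem a, j)) = top"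
          using x by blast
        then have "layer (initial_elem a, j) = n - 1"
          using layer(1) top by blast
        then show False
          using not_low[OF j(1)] card(1) by (simp add: pos_initial_elem n_def)
      qed
      then have "det (\<chi> a k. fst x (initial_elem (a :: 'n)) $ k) = 0"
        by (intro det_zero_column(2)[of top]) (simp add: column_def vec_eq_iff)
      then show "pullback r x = 0"
        by (intro vanish) (simp add: \<delta>_def pullback_minor_factor)
    qed
  next
    case cols
    have no_chain': "\<not> chain (\<lambda>v w. southeast w v) ?K p (Suc n)" for p
      using chain_reverse no_chain by blast
    obtain layer where layer: "\<forall>v\<in>?K. layer v < n"
      "\<forall>v\<in>?K. \<forall>w\<in>?K. southeast w v \<longrightarrow> layer v \<noteq> layer w"
      "\<forall>v\<in>?K. \<exists>p. chain (\<lambda>v w. southeast w v) ?K p (Suc (layer v)) \<and> p (layer v) = v"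
      using layers_of_no_chain[OF no_chain'] by blast
    have not_high: "pos (snd v) < CARD('q) - n" if v: "v \<in> ?K" "layer v = n - 1" for v
    proof (rule ccontr)
      assume high: "\<not> pos (snd v) < CARD('q) - n"
      obtain p where p: "chain (\<lambda>v w. southeast w v) ?K p n" "p (n - 1) = v"
        using layer(3) v n by fastforce
      define p' where "p' a = p (n - Suc a)" for a
      have p': "chain southeast ?K p' n" "p' 0 = v"
        using chain_reverse[OF p(1)] p(2) unfolding p'_def by simp_all
      have "pos (snd (p' a)) = CARD('q) - n + a" if "a < n" for a
        using chain_gap(2)[OF p'(1) that, of 0] chain_bounds(2)[OF p'(1) that] high card(2)
        by (simp add: p'(2) n_def)
      then show False using cols p'(1) by blast
    qed
    show ?thesis
    proof (rule coefficient_eq_0_of_layering[OF inf max, where layer = "\<lambda>v. elem_at (layer v) :: 'n"])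
      show "(elem_at (layer v) :: 'n) \<noteq> elem_at (layer w)" if "v \<in> ?K" "w \<in> ?K" "southeast v w" for v w
      proof -
        have "layer w \<noteq> layer v" using layer(2) that by blast
        then show ?thesis using layer(1) that by (simp add: elem_at_eq_iff n_def)
      qed
      fix x :: "('k, 'n, 'm, 'q) space"
      assume x: "\<And>j k. dual_apply (snd x j) (axis k 1) \<noteq> 0 \<Longrightarrow> \<exists>i. (i, j) \<in> ?K \<and> elem_at (layer (i, j)) = k"
      have "dual_apply (snd x (final_elem (a :: 'n))) (axis top 1) = 0" for a
      proof (rule ccontr)
        assume "dual_apply (snd x (final_elem a)) (axis top 1) \<noteq> 0"
        then obtain i where i: "(i, final_elem a) \<in> ?K" "elem_at (layer (i, final_elem a)) = top"
          using x by blast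
        then have "layer (i, final_elem a) = n - 1"
          using layer(1) top by blast
        then show False
          using not_high[OF i(1)] card(2) by (simp add: pos_final_elem n_def)
      qed
      then have "det (\<chi> k b. dual_apply (snd x (final_elem (b :: 'n))) (axis k 1)) = 0"
        by (intro det_zero_row(2)[of top]) (simp add: row_def vec_eq_iff)
      then show "pullback r x = 0"
        by (intro vanish) (simp add: \<delta>_def pullback_minor_factor)
    qed
  qed
qed

lemma vanishing_imp_in_ideal:
  fixes p :: "('m::finite \<times> 'q::finite, 'k::field) mpoly"
  defines "\<delta> \<equiv> minor (initial_elem :: 'n::finite \<Rightarrow> 'm) (final_elem :: 'n \<Rightarrow> 'q) :: ('m \<times> 'q, 'k::field) mpoly"
  assumes inf: "infinite (UNIV :: 'k set)" and card: "CARD('n) \<le> CARD('m)" "CARD('n) \<le> CARD('q)"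
    and vanish: "\<And>x :: ('k, 'n, 'm, 'q) space. pullback \<delta> x = 0 \<Longrightarrow> pullback p x = 0"
  shows "p \<in> ideal_generated (insert \<delta> (minors TYPE('n option) (\<chi> i j. indet (i, j))))"
    (is "p \<in> ideal_generated ?S")
proof -
  obtain r where r: "p - r \<in> ideal_generated ?S"
    and irred: "\<And>t g. t \<in> Poly_Mapping.keys r \<Longrightarrow> g \<in> ideal_generated ?S \<Longrightarrow> \<not> led_by g t"
    using reduction[of p ?S] by blast
  have "pullback r x = 0" if "pullback \<delta> x = 0" for x :: "('k, 'n, 'm, 'q) space"
  proof -
    have "pullback (p - r) x = 0"
      using r by (rule pullback_ideal) (auto simp: that minors_eq pullback_minor_option)
    then show ?thesis using vanish[OF that] by (simp add: substitute_diff)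
  qed
  note vanish_r = this
  have "r = 0"
  proof (rule ccontr)
    assume "r \<noteq> 0"
    then obtain t where t: "t \<in> Poly_Mapping.keys r"
      "\<And>t'. t' \<in> Poly_Mapping.keys r \<Longrightarrow> exponent_weight t' \<le> exponent_weight t"
      using exists_max_weight by blast
    have "t \<notin> Poly_Mapping.keys r"
      by (rule not_key_of_irreducible[OF inf card vanish_r[unfolded \<delta>_def] irred[OF t(1), unfolded \<delta>_def] t(2)])
    then show False using t(1) by blast
  qed
  then show ?thesis using r by simp
qed

section \<open>Polynomial functions\<close>

lemma generated_algebra_least:
  assumes "S \<subseteq> generated_algebra T"
  shows "generated_algebra S \<subseteq> generated_algebra T"
proof
  fix f assume "f \<in> generated_algebra S"
  then show "f \<in> generated_algebra T"
    by induction (use assms in \<open>auto intro: generated_algebra.intros\<close>)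
qed

lemma generated_algebra_sum:
  assumes "\<And>a. a \<in> A \<Longrightarrow> f a \<in> generated_algebra S"
  shows "(\<lambda>x. \<Sum>a\<in>A. f a x) \<in> generated_algebra S"
  using assms
  by (induction A rule: infinite_finite_induct)
    (auto intro: generated_algebra.const generated_algebra.add)

lemma generated_algebra_prod:
  assumes "\<And>a. a \<in> A \<Longrightarrow> f a \<in> generated_algebra S"
  shows "(\<lambda>x. \<Prod>a\<in>A. f a x) \<in> generated_algebra S"
  using assms
  by (induction A rule: infinite_finite_induct)
    (auto intro: generated_algebra.const generated_algebra.mult)

lemma generated_algebra_power:
  assumes "f \<in> generated_algebra S"
  shows "(\<lambda>x. f x ^ k) \<in> generated_algebra S"
  by (induction k) (auto intro: generated_algebra.const generated_algebra.mult assms)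

text \<open>
  Part (1) of the theorem speaks of generated algebras; this makes their elements polynomials in the
  generators.
\<close>

lemma generated_algebra_range:
  fixes F :: "'v \<Rightarrow> 'x \<Rightarrow> 'k::comm_ring_1"
  shows "generated_algebra (range F) = range (substitute F)"
proof (intro subset_antisym subsetI)
  fix f assume "f \<in> generated_algebra (range F)"
  then show "f \<in> range (substitute F)"
  proof induction
    case (gen f)
    then show ?case using substitute_indet[of F] by (metis rangeE rangeI)
  next
    case (const c)
    then show ?case using substitute_const[of F c] by (metis rangeI)
  next
    case (add f h)
    then show ?case by (auto simp: substitute_add[symmetric])
  next
    case (mult f h)
    then show ?case by (auto simp: substitute_mult[symmetric])
  qed
next
  fix f assume "f \<in> range (substitute F)"
  then show "f \<in> generated_algebra (range F)"
    unfolding substitute_def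
    by (auto intro!: generated_algebra_sum generated_algebra_prod generated_algebra_power
        generated_algebra.mult generated_algebra.const intro: generated_algebra.gen)
qed

lemma range_phi: "{f. \<exists>i j. f = \<phi> i j} = range (\<lambda>(i, j). \<phi> i j)"
  by auto

lemma phi_in_coordinate_ring: "\<phi> i j \<in> coordinate_ring"
proof -
  have "\<phi> i j = (\<lambda>x. \<Sum>k\<in>UNIV. fst x i $ k * dual_apply (snd x j) (axis k 1))"
    by (rule ext) (rule phi_sum)
  also have "\<dots> \<in> coordinate_ring"
    unfolding coordinate_ring_def coordinate_functions_def
    by (intro generated_algebra_sum generated_algebra.mult generated_algebra.gen) auto
  finally show ?thesis .
qed

lemma pullback_in_coordinate_ring: "pullback p \<in> coordinate_ring"
proof -
  have "generated_algebra {f. \<exists>i j. f = \<phi> i j} \<subseteq> coordinate_ring"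
    using phi_in_coordinate_ring unfolding coordinate_ring_def
    by (intro generated_algebra_least) auto
  then show ?thesis
    unfolding range_phi generated_algebra_range by blast
qed

lemma phi_act:
  assumes "g \<in> GL"
  shows "\<phi> i j (act g x) = \<phi> i j x"
proof -
  have "inv g (g v) = v" for v
    using assms by (simp add: GL_def bij_is_inj)
  then show ?thesis
    by (simp add: \<phi>_def act_def dual_apply_dual_act[OF assms])
qed

lemma pullback_invariant: "pullback p \<in> invariants"
proof -
  have "pullback p (act g x) = pullback p x" if "g \<in> GL" for g x
    unfolding substitute_def using that by (simp add: phi_act split_def)
  then show ?thesis
    unfolding invariants_def using pullback_in_coordinate_ring by blast
qed

lemma point_coordinates: "\<exists>y. x = point y"
proof -
  define y where "y w = (case w of Inl (i, k) \<Rightarrow> fst x i $ k | Inr (k, j) \<Rightarrow> dual_apply (snd x j) (axis k 1))" for w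
  have "dual_apply (snd x j) v = dual_apply (snd (point y) j) v" for j v
  proof -
    interpret Vector_Spaces.linear "(*s)" "(*)" "dual_apply (snd x j)"
      using dual_apply[of "snd x j"] by simp
    have "dual_apply (snd x j) v = dual_apply (snd x j) (\<Sum>k\<in>UNIV. v $ k *s axis k 1)"
      by (simp add: basis_expansion)
    then show ?thesis
      by (simp add: sum scale dual_apply_point y_def mult.commute)
  qed
  then have "snd x j = snd (point y) j" for j
    by (metis dual_apply_inject ext)
  moreover have "fst x i = fst (point y) i" for i
    by (simp add: vec_eq_iff y_def)
  ultimately show ?thesis
    by (intro exI[of _ y]) (auto simp: prod_eq_iff)
qed

lemma coordinate_ring_line:
  assumes "f \<in> coordinate_ring"
  shows "\<exists>P. \<forall>s. f (point (\<lambda>w. y w + s * z w)) = poly P s"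
  using assms unfolding coordinate_ring_def
proof induction
  case (gen f)
  then consider i a where "f = (\<lambda>x. fst x i $ a)" | j a where "f = (\<lambda>x. dual_apply (snd x j) (axis a 1))"
    unfolding coordinate_functions_def by blast
  then show ?case
  proof cases
    case (1 i a)
    then show ?thesis
      by (intro exI[of _ "[:y (Inl (i, a)), z (Inl (i, a)):]"]) simp
  next
    case (2 j a)
    then show ?thesis
      by (intro exI[of _ "[:y (Inr (a, j)), z (Inr (a, j)):]"]) simp
  qed
next
  case (const c)
  then show ?case by (intro exI[of _ "[:c:]"]) simp
next
  case (add f h)
  then obtain P Q where "\<forall>s. f (point (\<lambda>w. y w + s * z w)) = poly P s"
    "\<forall>s. h (point (\<lambda>w. y w + s * z w)) = poly Q s" by blast
  then show ?case by (intro exI[of _ "P + Q"]) simp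
next
  case (mult f h)
  then obtain P Q where "\<forall>s. f (point (\<lambda>w. y w + s * z w)) = poly P s"
    "\<forall>s. h (point (\<lambda>w. y w + s * z w)) = poly Q s" by blast
  then show ?case by (intro exI[of _ "P * Q"]) simp
qed

text \<open>
  Polynomial functions over an infinite field form a domain, as is seen by restricting to a line
  through the point in question and a point where the second factor does not vanish.
\<close>

lemma coordinate_ring_cancel:
  fixes f :: "('k::field, 'n::finite, 'm, 'q) space \<Rightarrow> 'k"
  assumes inf: "infinite (UNIV :: 'k set)"
    and "f \<in> coordinate_ring" "h \<in> coordinate_ring" and zero: "\<And>x. f x * h x = 0" and h: "h x0 \<noteq> 0"
  shows "f x = 0"
proof -
  obtain y y0 where y: "x = point y" "x0 = point y0"
    using point_coordinates by metis
  obtain P where P: "\<forall>s. f (point (\<lambda>w. y w + s * (y0 w - y w))) = poly P s"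
    using coordinate_ring_line[OF assms(2), of y "\<lambda>w. y0 w - y w"] by blast
  obtain Q where Q: "\<forall>s. h (point (\<lambda>w. y w + s * (y0 w - y w))) = poly Q s"
    using coordinate_ring_line[OF assms(3), of y "\<lambda>w. y0 w - y w"] by blast
  have "poly (P * Q) s = 0" for s
    using P Q zero by (metis poly_mult)
  then have "P * Q = 0"
    using poly_roots_finite[of "P * Q"] inf by auto
  moreover have "poly Q 1 \<noteq> 0"
    using Q[rule_format, of 1] h y(2) by simp
  ultimately have "P = 0" by auto
  then show ?thesis
    using P[rule_format, of 0] y(1) by simp
qed

section \<open>The first fundamental theorem\<close>

lemma substitute_power: "substitute F (p ^ k) x = substitute F p x ^ k"
  by (induction k) (simp_all add: substitute_one substitute_mult)

text \<open>
  Cramer's rule: the coordinates of \<open>u\<^sub>i\<close> in the basis of the vectors \<open>u\<^sub>\<rho>\<^sub>a\<close> are quotients of minors of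
  \<open>A\<close>. Multiplying numerator and denominator by the same minor of \<open>B\<close> makes them quotients of minors of \<open>A B\<close>.
\<close>

lemma pullback_minor_replace_row:
  fixes x :: "('k::field, 'n::finite, 'm, 'q) space" and \<rho> :: "'n \<Rightarrow> 'm"
  assumes g: "g \<in> GL" and frame: "\<And>a. g (fst x (\<rho> a)) = axis a 1"
  shows "pullback (minor (\<rho>(b := i)) \<gamma>) x = g (fst x i) $ b * pullback (minor \<rho> \<gamma>) x"
proof -
  interpret Vector_Spaces.linear "(*s)" "(*s)" g
    using g by (simp add: GL_def)
  define A where "A = (\<chi> a k. fst x (\<rho> a) $ k)"
  have row: "row a A = fst x (\<rho> a)" for a
    by (simp add: A_def row_def vec_eq_iff)
  have "g (\<Sum>a\<in>UNIV. g (fst x i) $ a *s row a A) = g (fst x i)"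
    by (simp add: row sum scale frame basis_expansion)
  then have expansion: "(\<Sum>a\<in>UNIV. g (fst x i) $ a *s row a A) = fst x i"
    using g by (auto simp: GL_def bij_def dest: injD)
  have "(\<chi> a k. fst x ((\<rho>(b := i)) a) $ k) =
      (\<chi> a. if a = b then \<Sum>a\<in>UNIV. g (fst x i) $ a *s row a A else row a A)"
    by (simp only: expansion) (simp add: vec_eq_iff row)
  then have "det (\<chi> a k. fst x ((\<rho>(b := i)) a) $ k) = g (fst x i) $ b * det A"
    by (simp only: cramer_lemma_transpose)
  then show ?thesis
    by (simp add: pullback_minor_factor A_def)
qed

text \<open>
  If \<open>g\<close> moves the vectors \<open>u\<^sub>\<rho>\<^sub>a\<close> to the standard basis, then the coordinates of \<open>g u\<^sub>i\<close> are given by the preceding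
  lemma, and those of \<open>\<xi>\<^sub>j\<close> after the action of \<open>g\<close> are the values \<open>\<xi>\<^sub>j(u\<^sub>\<rho>\<^sub>a)\<close>.
\<close>

lemma coordinate_ring_localized:
  fixes f :: "('k::field, 'n::finite, 'm, 'q) space \<Rightarrow> 'k" and \<rho> :: "'n \<Rightarrow> 'm"
  assumes "f \<in> coordinate_ring"
  shows "\<exists>p k. \<forall>g\<in>GL. \<forall>x. (\<forall>a. g (fst x (\<rho> a)) = axis a 1) \<longrightarrow>
    f (act g x) * pullback (minor \<rho> \<gamma>) x ^ k = pullback p x"
  using assms unfolding coordinate_ring_def
proof induction
  case (gen f)
  then consider i b where "f = (\<lambda>x. fst x i $ b)" | j b where "f = (\<lambda>x. dual_apply (snd x j) (axis b 1))"
    unfolding coordinate_functions_def by blast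
  then show ?case
  proof cases
    case (1 i b)
    then show ?thesis
      by (intro exI[of _ "minor (\<rho>(b := i)) \<gamma>"] exI[of _ 1])
        (auto simp: act_def pullback_minor_replace_row)
  next
    case (2 j b)
    have "dual_apply (dual_act g (snd x j)) (axis b 1) = \<phi> (\<rho> b) j x"
      if g: "g \<in> GL" and frame: "\<forall>a. g (fst x (\<rho> a)) = axis a 1" for g and x :: "('k, 'n, 'm, 'q) space"
    proof -
      have "inv g (axis b 1) = fst x (\<rho> b)"
        using g frame by (metis (mono_tags, lifting) GL_def bij_is_inj inv_f_f mem_Collect_eq)
      then show ?thesis by (simp add: dual_apply_dual_act[OF g] \<phi>_def)
    qed
    then show ?thesis
      by (intro exI[of _ "indet (\<rho> b, j)"] exI[of _ 0]) (simp add: 2 act_def substitute_indet)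
  qed
next
  case (const c)
  then show ?case
    by (intro exI[of _ "Poly_Mapping.single 0 c"] exI[of _ 0]) (simp add: substitute_const)
next
  case (add f h)
  then obtain p k p' k' where *: "\<forall>g\<in>GL. \<forall>x. (\<forall>a. g (fst x (\<rho> a)) = axis a 1) \<longrightarrow>
      f (act g x) * pullback (minor \<rho> \<gamma>) x ^ k = pullback p x"
    "\<forall>g\<in>GL. \<forall>x. (\<forall>a. g (fst x (\<rho> a)) = axis a 1) \<longrightarrow>
      h (act g x) * pullback (minor \<rho> \<gamma>) x ^ k' = pullback p' x"
    by blast
  show ?case
  proof (intro exI ballI allI impI)
    fix g and x :: "('k, 'n, 'm, 'q) space"
    let ?\<delta> = "pullback (minor \<rho> \<gamma>) x"
    assume "g \<in> GL" "\<forall>a. g (fst x (\<rho> a)) = axis a 1"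
    then have eq: "f (act g x) * ?\<delta> ^ k = pullback p x" "h (act g x) * ?\<delta> ^ k' = pullback p' x"
      using * by blast+
    have "(f (act g x) + h (act g x)) * ?\<delta> ^ (k + k') =
        (f (act g x) * ?\<delta> ^ k) * ?\<delta> ^ k' + (h (act g x) * ?\<delta> ^ k') * ?\<delta> ^ k"
      by (simp only: power_add distrib_right mult_ac)
    then show "(f (act g x) + h (act g x)) * ?\<delta> ^ (k + k') =
        pullback (p * minor \<rho> \<gamma> ^ k' + p' * minor \<rho> \<gamma> ^ k) x"
      by (simp only: eq substitute_add substitute_mult substitute_power)
  qed
next
  case (mult f h)
  then obtain p k p' k' where *: "\<forall>g\<in>GL. \<forall>x. (\<forall>a. g (fst x (\<rho> a)) = axis a 1) \<longrightarrow>
      f (act g x) * pullback (minor \<rho> \<gamma>) x ^ k = pullback p x"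
    "\<forall>g\<in>GL. \<forall>x. (\<forall>a. g (fst x (\<rho> a)) = axis a 1) \<longrightarrow>
      h (act g x) * pullback (minor \<rho> \<gamma>) x ^ k' = pullback p' x"
    by blast
  show ?case
  proof (intro exI ballI allI impI)
    fix g and x :: "('k, 'n, 'm, 'q) space"
    let ?\<delta> = "pullback (minor \<rho> \<gamma>) x"
    assume "g \<in> GL" "\<forall>a. g (fst x (\<rho> a)) = axis a 1"
    then have eq: "f (act g x) * ?\<delta> ^ k = pullback p x" "h (act g x) * ?\<delta> ^ k' = pullback p' x"
      using * by blast+
    have "(f (act g x) * h (act g x)) * ?\<delta> ^ (k + k') =
        (f (act g x) * ?\<delta> ^ k) * (h (act g x) * ?\<delta> ^ k')"
      by (simp only: power_add mult_ac)
    then show "(f (act g x) * h (act g x)) * ?\<delta> ^ (k + k') = pullback (p * p') x"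
      by (simp only: eq substitute_mult)
  qed
qed

lemma exists_frame_change:
  fixes u :: "'n::finite \<Rightarrow> 'k::field ^ 'n"
  assumes "det (\<chi> a k. u a $ k) \<noteq> 0"
  obtains g where "g \<in> GL" "\<And>a. g (u a) = axis a 1"
proof -
  define M where "M = transpose (\<chi> a k. u a $ k)"
  have "det M \<noteq> 0" using assms by (simp add: M_def det_transpose)
  then obtain N where N: "N ** M = mat 1" "M ** N = mat 1"
    using invertible_det_nz[of M] unfolding invertible_def by auto
  have "bij ((*v) N)"
    by (rule bij_betw_byWitness[where f' = "(*v) M"]) (auto simp: matrix_vector_mul_assoc N)
  then have "(*v) N \<in> GL"
    by (simp add: GL_def matrix_vector_mul_linear_gen)
  moreover have "N *v u a = axis a 1" for a
  proof -
    have "u a = M *v axis a 1"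
      by (simp add: matrix_vector_mult_def M_def transpose_def vec_eq_iff axis_def if_distrib
          cong: if_cong)
    then show ?thesis by (simp add: matrix_vector_mul_assoc N)
  qed
  ultimately show thesis by (rule that)
qed

lemma invariant_times_power:
  fixes f :: "('k::field, 'n::finite, 'm, 'q) space \<Rightarrow> 'k" and \<rho> :: "'n \<Rightarrow> 'm"
  assumes "f \<in> invariants"
  shows "\<exists>p k. \<forall>x. f x * pullback (minor \<rho> \<gamma>) x ^ k = pullback p x"
proof -
  have f: "f \<in> coordinate_ring" "\<And>g x. g \<in> GL \<Longrightarrow> f (act g x) = f x"
    using assms by (auto simp: invariants_def)
  obtain p k where p: "\<forall>g\<in>GL. \<forall>x. (\<forall>a. g (fst x (\<rho> a)) = axis a 1) \<longrightarrow>
    f (act g x) * pullback (minor \<rho> \<gamma>) x ^ k = pullback p x"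
    using coordinate_ring_localized[OF f(1)] by blast
  \<comment> \<open>The additional factor makes the identity hold also where the minor vanishes.\<close>
  have "f x * pullback (minor \<rho> \<gamma>) x ^ Suc k = pullback (p * minor \<rho> \<gamma>) x" for x
  proof (cases "pullback (minor \<rho> \<gamma>) x = 0")
    case False
    then have "det (\<chi> a k. fst x (\<rho> a) $ k) \<noteq> 0" by (auto simp: pullback_minor_factor)
    then obtain g where g: "g \<in> GL" "\<And>a. g (fst x (\<rho> a)) = axis a 1"
      using exists_frame_change[of "\<lambda>a. fst x (\<rho> a)"] by blast
    then have "f x * pullback (minor \<rho> \<gamma>) x ^ k = pullback p x"
      using p f(2)[OF g(1), of x] by fastforce
    then show ?thesis by (simp add: substitute_mult mult_ac)
  qed (simp add: substitute_mult)
  then show ?thesis by blast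
qed

lemma factor_out:
  fixes a :: "'a::comm_ring_1"
  assumes "a * d ^ Suc k - c * d = 0"
  shows "(a * d ^ k + (- 1) * c) * d = 0"
proof -
  have "(a * d ^ k + (- 1) * c) * d = a * d ^ Suc k - c * d"
    by (simp add: algebra_simps)
  then show ?thesis by (simp only: assms)
qed

text \<open>
  Descent on the exponent \<open>k\<close>: both sides of \<open>f \<delta>\<^sup>k = P(A B)\<close> vanish with \<open>\<delta>\<close>, so \<open>P\<close> is a multiple
  of \<open>\<delta>\<close> modulo relations, and \<open>\<delta>\<close> can be cancelled.
\<close>

lemma divide_by_minor:
  fixes f :: "('k::field, 'n::finite, 'm::finite, 'q::finite) space \<Rightarrow> 'k"
  defines "\<delta> \<equiv> minor (initial_elem :: 'n \<Rightarrow> 'm) (final_elem :: 'n \<Rightarrow> 'q) :: ('m \<times> 'q, 'k) mpoly"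
  assumes inf: "infinite (UNIV :: 'k set)" and card: "CARD('n) \<le> CARD('m)" "CARD('n) \<le> CARD('q)"
    and f: "f \<in> coordinate_ring" and "\<And>x. f x * pullback \<delta> x ^ k = pullback p x"
  shows "f \<in> range pullback"
  using assms(6)
proof (induction k arbitrary: p)
  case 0
  then have "f = pullback p" by (intro ext) simp
  then show ?case by blast
next
  case (Suc k)
  have "pullback p x = 0" if "pullback \<delta> x = 0" for x :: "('k, 'n, 'm, 'q) space"
    using Suc.prems[of x] that by simp
  then have "p \<in> ideal_generated (insert \<delta> (minors TYPE('n option) (\<chi> i j. indet (i, j))))"
    unfolding \<delta>_def by (rule vanishing_imp_in_ideal[OF inf card])
  then obtain q where "p - q * \<delta> \<in> determinantal_ideal TYPE('n option)"
    unfolding ideal_insert by blast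
  then have "pullback (p - q * \<delta>) x = 0" for x :: "('k, 'n, 'm, 'q) space"
    by (rule pullback_determinantal_ideal)
  then have eq: "f x * pullback \<delta> x ^ Suc k - pullback q x * pullback \<delta> x = 0" for x
    unfolding Suc.prems by (simp only: substitute_diff substitute_mult)
  have zero: "(f x * pullback \<delta> x ^ k + (- 1) * pullback q x) * pullback \<delta> x = 0" for x
    by (rule factor_out[OF eq])
  \<comment> \<open>A point where \<open>\<delta>\<close> does not vanish: both of its blocks are identity matrices.\<close>
  define y :: "('m \<times> 'n) + ('n \<times> 'q) \<Rightarrow> 'k"
    where "y w = (case w of Inl (i, k) \<Rightarrow> of_bool (i = initial_elem k) | Inr (k, j) \<Rightarrow> of_bool (j = final_elem k))" for w
  have "(\<chi> a k. fst (point y) (initial_elem (a :: 'n)) $ k) = mat 1"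
    by (simp add: vec_eq_iff mat_def y_def initial_elem_eq_iff[OF card(1)] of_bool_def)
  moreover have "(\<chi> k b. dual_apply (snd (point y) (final_elem (b :: 'n))) (axis k 1)) = mat 1"
    by (simp add: vec_eq_iff mat_def y_def final_elem_eq_iff[OF card(2)] of_bool_def)
  ultimately have nonzero: "pullback \<delta> (point y) \<noteq> 0"
    unfolding \<delta>_def by (simp add: pullback_minor_factor)
  have "f x * pullback \<delta> x ^ k + (- 1) * pullback q x = 0" for x
  proof (rule coordinate_ring_cancel[OF inf _ pullback_in_coordinate_ring zero nonzero])
    show "(\<lambda>x. f x * pullback \<delta> x ^ k + (- 1) * pullback q x) \<in> coordinate_ring"
      using f pullback_in_coordinate_ring[of \<delta>] pullback_in_coordinate_ring[of q]
      unfolding coordinate_ring_def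
      by (intro generated_algebra.add generated_algebra.mult generated_algebra_power generated_algebra.const)
  qed
  then show ?case by (intro Suc.IH[of q]) simp
qed

theorem first_fundamental_theorem:
  assumes "infinite (UNIV :: 'k set)" and "CARD('n) \<le> CARD('m)" "CARD('n) \<le> CARD('q)"
  shows "(invariants :: (('k::field, 'n::finite, 'm::finite, 'q::finite) space \<Rightarrow> 'k) set) = range pullback"
proof (intro subset_antisym subsetI)
  fix f :: "('k, 'n, 'm, 'q) space \<Rightarrow> 'k"
  assume f: "f \<in> invariants"
  obtain p k where "\<And>x. f x *
      pullback (minor (initial_elem :: 'n \<Rightarrow> 'm) (final_elem :: 'n \<Rightarrow> 'q)) x ^ k = pullback p x"
    using invariant_times_power[OF f, of initial_elem final_elem] by blast
  moreover have "f \<in> coordinate_ring" using f by (simp add: invariants_def)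
  ultimately show "f \<in> range pullback"
    using divide_by_minor[OF assms] by blast
next
  fix f :: "('k, 'n, 'm, 'q) space \<Rightarrow> 'k"
  assume "f \<in> range pullback"
  then show "f \<in> invariants" using pullback_invariant by blast
qed

lemma infinite_alg_closed_field: "infinite (UNIV :: 'k::alg_closed_field set)"
proof
  assume fin: "finite (UNIV :: 'k set)"
  \<comment> \<open>The polynomial \<open>P + 1\<close> has no root.\<close>
  define P where "P = (\<Prod>a\<in>UNIV. [:- a, 1 :: 'k:])"
  have "degree P = card (UNIV :: 'k set)"
    unfolding P_def by (subst degree_prod_eq_sum_degree) (auto simp: fin)
  moreover have "card (UNIV :: 'k set) > 0" using fin by (simp add: card_gt_0_iff)
  ultimately have "degree (P + 1) > 0" by (simp add: degree_add_eq_left)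
  then obtain z where "poly (P + 1) z = 0"
    using alg_closed_imp_poly_has_root by blast
  moreover have "poly P z = 0"
    using fin unfolding P_def poly_prod by (auto intro: prod_zero)
  ultimately show False by simp
qed

theorem theorem2p2p3:
  assumes "CARD('n::finite) < CARD('m::finite)" and "CARD('n) < CARD('q::finite)"
  shows "(invariants :: (('k::alg_closed_field, 'n, 'm, 'q) space \<Rightarrow> 'k) set) =
           generated_algebra {f. \<exists>i j. f = \<phi> i j}
       \<and> {p :: ('m \<times> 'q, 'k) mpoly.
            substitute (\<lambda>(i, j). (\<phi> i j :: ('k, 'n, 'm, 'q) space \<Rightarrow> 'k)) p = (\<lambda>_. 0)} =
           ideal_generated (minors TYPE('n option) (\<chi> i j. indet (i, j)))"
proof
  show "(invariants :: (('k, 'n, 'm, 'q) space \<Rightarrow> 'k) set) = generated_algebra {f. \<exists>i j. f = \<phi> i j}"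
    unfolding range_phi generated_algebra_range
    by (rule first_fundamental_theorem[OF infinite_alg_closed_field]) (use assms in auto)
  show "{p :: ('m \<times> 'q, 'k) mpoly.
      substitute (\<lambda>(i, j). (\<phi> i j :: ('k, 'n, 'm, 'q) space \<Rightarrow> 'k)) p = (\<lambda>_. 0)} =
      ideal_generated (minors TYPE('n option) (\<chi> i j. indet (i, j)))"
    using second_fundamental_theorem[where 'n = 'n, OF infinite_alg_closed_field]
    by (auto simp: fun_eq_iff)
qed

end
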